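(* For every non-negative integer $k$ there exist constants $c(k), C(k) > 0$, depending only on $k$, such that for every integer $g \ge 2$ there exists a $k$-system $\Gamma$ of simple loops on the closed, connected, orientable surface $S_g$ of genus $g$ with $$c(k) \cdot g^{k+1} \le |\Gamma| \le C(k) \cdot g^{k+1}.$$ Furthermore, $\Gamma$ contains a loop that intersects every other loop in $\Gamma$.
   Context: A simple loop on a surface is a simple closed curve. For a non-negative integer $k$, a $k$-system on a surface $S$ is a set of simple loops on $S$ in which no two are homotopic or intersect in more than $k$ points.
   Formalization: The final clause (a loop of Γ intersecting every other loop) is asserted only for k ≥ 1: for k = 0 the loops are pairwise disjoint, so such a loop forces |Γ| = 1, contradicting |Γ| ≥ c(0)·g for large g. The size bounds are still asserted for k = 0. *)

theory Defs
  imports "HOL-Analysis.Analysis"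
begin

section \<open>Quotient topologies\<close>

definition quotient_topology :: "'a topology \<Rightarrow> ('a \<times> 'a) set \<Rightarrow> 'a set topology" where
  "quotient_topology X r = topology (\<lambda>U. U \<subseteq> topspace X // r \<and> openin X (\<Union>U))"

lemma openin_quotient_topology:
  assumes r: "equiv (topspace X) r"
  shows "openin (quotient_topology X r) U \<longleftrightarrow> U \<subseteq> topspace X // r \<and> openin X (\<Union>U)"
proof -
  have int: "\<Union>(S \<inter> T) = \<Union>S \<inter> \<Union>T" if "S \<subseteq> topspace X // r" "T \<subseteq> topspace X // r" for S T
    using quotient_disj[OF r] that by blast
  have "istopology (\<lambda>U. U \<subseteq> topspace X // r \<and> openin X (\<Union>U))"
    unfolding istopology_def
  proof (intro conjI allI impI)
    fix S T
    assume S: "S \<subseteq> topspace X // r \<and> openin X (\<Union>S)" and T: "T \<subseteq> topspace X // r \<and> openin X (\<Union>T)"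
    show "S \<inter> T \<subseteq> topspace X // r" using S by blast
    show "openin X (\<Union>(S \<inter> T))" using S T int by (simp add: openin_Int)
  next
    fix K
    assume K: "\<forall>U\<in>K. U \<subseteq> topspace X // r \<and> openin X (\<Union>U)"
    then show "\<Union>K \<subseteq> topspace X // r" by blast
    have "\<Union>(\<Union>K) = \<Union>(Union ` K)" by blast
    then show "openin X (\<Union>(\<Union>K))" using K by auto
  qed
  then show ?thesis by (simp add: quotient_topology_def)
qed

lemma topspace_quotient_topology:
  assumes r: "equiv (topspace X) r"
  shows "topspace (quotient_topology X r) = topspace X // r"
proof (rule antisym)
  show "topspace (quotient_topology X r) \<subseteq> topspace X // r"
    using openin_quotient_topology[OF r] by (metis openin_topspace)
  have "openin (quotient_topology X r) (topspace X // r)"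
    by (simp add: openin_quotient_topology[OF r] Union_quotient[OF r])
  then show "topspace X // r \<subseteq> topspace (quotient_topology X r)"
    by (rule openin_subset)
qed

lemma quotient_map_quotient_topology:
  assumes r: "equiv (topspace X) r"
  shows "quotient_map X (quotient_topology X r) (\<lambda>x. r `` {x})"
  unfolding quotient_map_def
proof (intro conjI allI impI)
  show "(\<lambda>x. r `` {x}) ` topspace X = topspace (quotient_topology X r)"
    by (auto simp: topspace_quotient_topology[OF r] quotient_def)
next
  fix U
  assume "U \<subseteq> topspace (quotient_topology X r)"
  then have U: "U \<subseteq> topspace X // r"
    by (simp add: topspace_quotient_topology[OF r])
  have "{x \<in> topspace X. r `` {x} \<in> U} = \<Union>U"
  proof (intro set_eqI iffI)
    fix x
    assume "x \<in> {x \<in> topspace X. r `` {x} \<in> U}"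
    then show "x \<in> \<Union>U" using equiv_class_self[OF r] by blast
  next
    fix x
    assume "x \<in> \<Union>U"
    then obtain A where A: "A \<in> U" "x \<in> A" by blast
    then obtain a where a: "a \<in> topspace X" "A = r `` {a}"
      using U by (auto elim: quotientE)
    then have "(a, x) \<in> r" using A by simp
    then have "r `` {x} = A" "x \<in> topspace X"
      using equiv_class_eq[OF r] a equiv_type[OF r] by auto
    then show "x \<in> {x \<in> topspace X. r `` {x} \<in> U}" using A by simp
  qed
  then show "openin X {x \<in> topspace X. r `` {x} \<in> U} = openin (quotient_topology X r) U"
    using U by (simp add: openin_quotient_topology[OF r])
qed


section \<open>The closed orientable surface of genus \<open>g\<close>\<close>

text \<open>
  The surface is the closed unit disc, viewed as a polygon with \<open>4 * g\<close> sides, with its sides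
  glued according to the word
  \<open>a\<^sub>1 b\<^sub>1 a\<^sub>1\<^sup>-\<^sup>1 b\<^sub>1\<^sup>-\<^sup>1 \<dots> a\<^sub>g b\<^sub>g a\<^sub>g\<^sup>-\<^sup>1 b\<^sub>g\<^sup>-\<^sup>1\<close>.
  Side \<open>j\<close> (for \<open>j < 4 * g\<close>) is the arc from \<open>polygon_point g j\<close> to \<open>polygon_point g (j + 1)\<close>.
  The sides with \<open>j mod 4\<close> equal to \<open>0\<close> and \<open>1\<close> carry the letters \<open>a\<^sub>i\<close> and \<open>b\<^sub>i\<close>; each of them
  is glued to side \<open>j + 2\<close> with reversed direction, so that the point at parameter \<open>j + s\<close> is
  identified with the point at parameter \<open>(j + 3) - s\<close>.
\<close>

definition polygon_point :: "nat \<Rightarrow> real \<Rightarrow> complex" where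
  "polygon_point g t = cis (2 * pi * t / (4 * real g))"

definition side_pairing :: "nat \<Rightarrow> complex \<Rightarrow> complex \<Rightarrow> bool" where
  "side_pairing g x y \<longleftrightarrow>
     (\<exists>j s. j < 4 * g \<and> j mod 4 \<in> {0, 1} \<and> 0 \<le> s \<and> s \<le> 1 \<and>
        x = polygon_point g (real j + s) \<and> y = polygon_point g (real j + 3 - s))"

definition surface_rel :: "nat \<Rightarrow> (complex \<times> complex) set" where
  "surface_rel g = {(x, y). x \<in> cball 0 1 \<and> y \<in> cball 0 1 \<and> equivclp (side_pairing g) x y}"

definition genus_surface :: "nat \<Rightarrow> complex set topology" where
  "genus_surface g = quotient_topology (top_of_set (cball 0 1)) (surface_rel g)"

lemma equiv_surface_rel: "equiv (cball 0 1) (surface_rel g)"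
proof (rule equivI)
  show "surface_rel g \<subseteq> cball 0 1 \<times> cball 0 1"
    by (auto simp: surface_rel_def)
  show "refl_on (cball 0 1) (surface_rel g)"
    by (auto simp: surface_rel_def refl_on_def)
  show "sym (surface_rel g)"
    by (auto simp: surface_rel_def sym_def intro: equivclp_sym)
  show "trans (surface_rel g)"
    by (auto simp: surface_rel_def trans_def intro: equivclp_trans)
qed

lemma quotient_map_genus_surface:
  "quotient_map (top_of_set (cball 0 1)) (genus_surface g) (\<lambda>x. surface_rel g `` {x})"
  unfolding genus_surface_def
  by (rule quotient_map_quotient_topology) (simp add: equiv_surface_rel)

lemma topspace_genus_surface: "topspace (genus_surface g) = cball 0 1 // surface_rel g"
  unfolding genus_surface_def
  by (subst topspace_quotient_topology) (simp_all add: equiv_surface_rel)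

lemma compact_space_genus_surface: "compact_space (genus_surface g)"
proof -
  have "compact_space (top_of_set (cball (0::complex) 1))"
    by (simp add: compact_space_subtopology)
  then show ?thesis
    using quotient_map_genus_surface
    by (metis compact_space_def image_compactin quotient_imp_continuous_map
        quotient_imp_surjective_map)
qed

lemma connected_space_genus_surface: "connected_space (genus_surface g)"
proof -
  have "connected_space (top_of_set (cball (0::complex) 1))"
    by (simp add: connected_space_subtopology)
  then show ?thesis
    using quotient_map_genus_surface connected_space_quotient_map_image by blast
qed


section \<open>Loops and \<open>k\<close>-systems\<close>

text \<open>
  Simple loops are subsets of the surface rather than parametrised curves. Two simple loops are
  homotopic if they admit freely homotopic parametrisations; in particular they carry no
  orientation and no base point.
\<close>

definition simple_loop_param :: "'a topology \<Rightarrow> (complex \<Rightarrow> 'a) \<Rightarrow> 'a set \<Rightarrow> bool" where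
  "simple_loop_param X p \<gamma> \<longleftrightarrow>
     continuous_map (top_of_set (sphere 0 1)) X p \<and> inj_on p (sphere 0 1) \<and> p ` sphere 0 1 = \<gamma>"

definition simple_loop :: "'a topology \<Rightarrow> 'a set \<Rightarrow> bool" where
  "simple_loop X \<gamma> \<longleftrightarrow> (\<exists>p. simple_loop_param X p \<gamma>)"

definition homotopic_simple_loops :: "'a topology \<Rightarrow> 'a set \<Rightarrow> 'a set \<Rightarrow> bool" where
  "homotopic_simple_loops X \<gamma> \<delta> \<longleftrightarrow>
     (\<exists>p q. simple_loop_param X p \<gamma> \<and> simple_loop_param X q \<delta> \<and>
        homotopic_with (\<lambda>_. True) (top_of_set (sphere 0 1)) X p q)"

definition k_system :: "'a topology \<Rightarrow> nat \<Rightarrow> 'a set set \<Rightarrow> bool" where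
  "k_system X k \<Gamma> \<longleftrightarrow>
     (\<forall>\<gamma>\<in>\<Gamma>. simple_loop X \<gamma>) \<and>
     (\<forall>\<gamma>\<in>\<Gamma>. \<forall>\<delta>\<in>\<Gamma>. \<gamma> \<noteq> \<delta> \<longrightarrow>
        \<not> homotopic_simple_loops X \<gamma> \<delta> \<and> finite (\<gamma> \<inter> \<delta>) \<and> card (\<gamma> \<inter> \<delta>) \<le> k)"

text \<open>
  The loops of a \<open>0\<close>-system are pairwise disjoint, so a \<open>0\<close>-system containing a loop that meets
  all the others has only one member. The requirement that such a loop exists is therefore
  compatible with a lower bound linear in \<open>g\<close> only for \<open>k > 0\<close>.
\<close>

lemma zero_system_with_hub:
  assumes "k_system X 0 \<Gamma>" "\<gamma> \<in> \<Gamma>" "\<forall>\<delta>\<in>\<Gamma> - {\<gamma>}. \<gamma> \<inter> \<delta> \<noteq> {}"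
  shows "\<Gamma> = {\<gamma>}"
proof -
  have "\<gamma> \<inter> \<delta> = {}" if "\<delta> \<in> \<Gamma>" "\<delta> \<noteq> \<gamma>" for \<delta>
    using assms(1,2) that unfolding k_system_def by (metis card_0_eq le_zero_eq)
  then show ?thesis using assms(2,3) by blast
qed

end

theory Submission
  imports Defs
begin

text \<open>
  A loop meeting the sides of the polygon transversally is a cyclic sequence of chords of the disc.
  Split the handles into \<open>k + 1\<close> cyclically arranged blocks of about \<open>g / (k + 1)\<close> handles each.
  For every choice of one depth per block there is a loop that runs through that many handles of
  each block in turn. Straight chords cross at most once, and two such loops can only cross along
  the \<open>k + 1\<close> links between consecutive blocks; a parity argument excludes one crossing in every
  link, so there are at most \<open>k\<close> crossings. The depths can be read off from the degrees of the
  loops under suitable maps from the surface to the circle, hence distinct loops are not homotopic.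
  Finally, a side of the polygon is itself a loop, and it meets each of these loops exactly once.
\<close>

section \<open>Geometry of the polygon\<close>

text \<open>The exponent is the number of blocks: every block offers an independent choice among
  about \<open>g / (k + 1)\<close> depths, and every link costs at most one intersection. So
  \<open>k + 1\<close> free choices threaten to cost \<open>k + 1\<close> crossings, one more than
  allowed, and the whole design serves to save that one. Whether two links cross depends only on the
  linear order of their ends along the boundary. If all of them crossed, the order of the two loops
  would be reversed from each block to the next, all the way around the cycle. Closing up then
  contradicts the parity of \<open>k + 1\<close> when this number is odd; when it is even, the last
  block is built differently to shift the parity by one. Homotopy classes are separated without the
  fundamental group. It is enough that a circle-valued map has a continuous logarithm on one loop
  and none on the other, and this can be read off from the sides that the loops cross.\<close>

lemma polygon_point_eq_iff:
  assumes "0 < g"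
  shows "polygon_point g s = polygon_point g t \<longleftrightarrow> (\<exists>n::int. s = t + 4 * real g * of_int n)"
proof -
  have "polygon_point g s = polygon_point g t \<longleftrightarrow>
      (\<exists>n::int. 2 * pi * s / (4 * real g) = 2 * pi * t / (4 * real g) + 2 * pi * n)"
    using sin_cos_eq_iff[of "2 * pi * s / (4 * real g)" "2 * pi * t / (4 * real g)"]
    by (auto simp: polygon_point_def complex_eq_iff)
  also have "\<dots> \<longleftrightarrow> (\<exists>n::int. s = t + 4 * real g * of_int n)"
  proof (intro ex_cong1)
    fix n :: int
    have *: "x / D = y / D + z \<longleftrightarrow> x = y + D * z" if "D \<noteq> 0" for x y z D :: real
      using that by (auto simp: field_simps)
    have "2 * pi * s / (4 * real g) = 2 * pi * t / (4 * real g) + 2 * pi * n \<longleftrightarrow>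
        2 * pi * s = 2 * pi * (t + 4 * real g * n)"
      using assms *[of "4 * real g" "2 * pi * s" "2 * pi * t" "2 * pi * n"] by (simp add: algebra_simps)
    then show "(2 * pi * s / (4 * real g) = 2 * pi * t / (4 * real g) + 2 * pi * n) =
        (s = t + 4 * real g * n)" by simp
  qed
  finally show ?thesis .
qed

lemma norm_polygon_point [simp]: "norm (polygon_point g t) = 1"
  by (simp add: polygon_point_def)

lemma polygon_point_periodic [simp]: "0 < g \<Longrightarrow> polygon_point g (4 * real g + t) = polygon_point g t"
  by (subst polygon_point_eq_iff) (auto intro!: exI[of _ 1])

lemma polygon_point_inj:
  assumes "0 < g" "polygon_point g s = polygon_point g t" "\<bar>s - t\<bar> < 4 * real g"
  shows "s = t"
proof -
  obtain n :: int where n: "s = t + 4 * real g * of_int n"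
    using assms polygon_point_eq_iff by blast
  then have "4 * real g * \<bar>of_int n\<bar> < 4 * real g * 1"
    using assms by (simp add: abs_mult)
  then have "\<bar>n\<bar> < 1" using assms by (simp only: mult_less_cancel_left) linarith
  then show ?thesis using n by simp
qed

lemma inner_polygon_point:
  "polygon_point g s \<bullet> polygon_point g t = cos (2 * pi * (s - t) / (4 * real g))"
  by (simp add: polygon_point_def inner_complex_def cos_diff right_diff_distrib diff_divide_distrib)

text \<open>Cosine decreases on the first half of the period, and the reflection of \<open>t\<close>
  to \<open>4 * g - t\<close> reduces the second half to the first.\<close>

lemma cos_less_polygon:
  assumes "0 < g" "0 \<le> r" "r < t" "t < 4 * real g - r"
  shows "cos (2 * pi * t / (4 * real g)) < cos (2 * pi * r / (4 * real g))"
proof -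
  have *: "cos (2 * pi * t / (4 * real g)) < cos (2 * pi * r / (4 * real g))"
    if "r < t" "t \<le> 2 * real g" for t
    using that assms by (intro cos_monotone_0_pi) (auto simp: field_simps)
  show ?thesis
  proof (cases "t \<le> 2 * real g")
    case False
    have "cos (2 * pi * t / (4 * real g)) = cos (2 * pi - 2 * pi * t / (4 * real g))" by simp
    also have "2 * pi - 2 * pi * t / (4 * real g) = 2 * pi * (4 * real g - t) / (4 * real g)"
      using assms by (simp add: field_simps)
    finally show ?thesis using *[of "4 * real g - t"] False assms by simp
  qed (use *[of t] assms in blast)
qed

lemma cos_polygon_abs: "cos (2 * pi * \<bar>t\<bar> / (4 * real g)) = cos (2 * pi * t / (4 * real g))"
  by (cases "t \<ge> 0") auto

section \<open>Chords and the half planes they bound\<close>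

definition polygon_chord :: "nat \<Rightarrow> real \<times> real \<Rightarrow> complex set" where
  "polygon_chord g c = closed_segment (polygon_point g (fst c)) (polygon_point g (snd c))"

lemma inner_segment_le:
  assumes "z \<in> closed_segment a b" "a \<bullet> c \<le> (r::real)" "b \<bullet> c \<le> r"
  shows "z \<bullet> c \<le> r"
proof -
  obtain s where s: "0 \<le> s" "s \<le> 1" "z = (1 - s) *\<^sub>R a + s *\<^sub>R b"
    using assms(1) by (auto simp: in_segment)
  have "z \<bullet> c = (1 - s) * (a \<bullet> c) + s * (b \<bullet> c)" using s by (simp add: inner_left_distrib)
  also have "\<dots> \<le> (1 - s) * r + s * r" using s assms by (intro add_mono mult_left_mono) auto
  finally show ?thesis by (simp add: algebra_simps)
qed

lemma inner_segment_less:
  assumes "z \<in> closed_segment a b" "a \<bullet> c < (r::real)" "b \<bullet> c < r"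
  shows "z \<bullet> c < r"
  using inner_segment_le[OF assms(1), of c "max (a \<bullet> c) (b \<bullet> c)"] assms by auto

lemma inner_segment_eq:
  assumes "z \<in> closed_segment a b" "a \<bullet> c = (r::real)" "b \<bullet> c = r"
  shows "z \<bullet> c = r"
  using inner_segment_le[OF assms(1), of c r] inner_segment_le[OF assms(1), of "-c" "-r"] assms by auto

lemma inner_segment_gt:
  assumes "z \<in> closed_segment a b" "a \<bullet> c > (r::real)" "b \<bullet> c > r"
  shows "z \<bullet> c > r"
  using inner_segment_less[OF assms(1), of "-c" "-r"] assms by auto

text \<open>The chord from \<open>x\<close> to \<open>y\<close> lies on a line orthogonal to the radius through the midpoint of its arc.\<close>

lemma inner_mid_endpoint:
  "polygon_point g x \<bullet> polygon_point g ((x + y) / 2) = cos (2 * pi * ((y - x) / 2) / (4 * real g))"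
  "polygon_point g y \<bullet> polygon_point g ((x + y) / 2) = cos (2 * pi * ((y - x) / 2) / (4 * real g))"
proof -
  show "polygon_point g x \<bullet> polygon_point g ((x + y) / 2) = cos (2 * pi * ((y - x) / 2) / (4 * real g))"
    unfolding inner_polygon_point cos_polygon_abs[symmetric, of "x - (x + y) / 2"]
      cos_polygon_abs[symmetric, of "(y - x) / 2"]
    by (rule arg_cong[where f = "\<lambda>t. cos (2 * pi * t / (4 * real g))"]) (simp add: field_simps abs_if)
  show "polygon_point g y \<bullet> polygon_point g ((x + y) / 2) = cos (2 * pi * ((y - x) / 2) / (4 * real g))"
    unfolding inner_polygon_point
    by (rule arg_cong[where f = "\<lambda>t. cos (2 * pi * t / (4 * real g))"]) (simp add: field_simps)
qed

lemma inner_mid_inside: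
  assumes "0 < g" "x < t" "t < y" "y < x + 4 * real g"
  shows "polygon_point g t \<bullet> polygon_point g ((x + y) / 2) > cos (2 * pi * ((y - x) / 2) / (4 * real g))"
  unfolding inner_polygon_point cos_polygon_abs[symmetric, of "t - (x + y) / 2"]
  using assms by (intro cos_less_polygon) (auto simp: field_simps abs_if)

lemma inner_mid_outside:
  assumes "0 < g" "x < y" "y < t" "t < x + 4 * real g"
  shows "polygon_point g t \<bullet> polygon_point g ((x + y) / 2) < cos (2 * pi * ((y - x) / 2) / (4 * real g))"
  unfolding inner_polygon_point
  using assms by (intro cos_less_polygon) (auto simp: field_simps abs_if)

lemma chord_inner:
  "z \<in> polygon_chord g (x, y) \<Longrightarrow>
    z \<bullet> polygon_point g ((x + y) / 2) = cos (2 * pi * ((y - x) / 2) / (4 * real g))"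
  unfolding polygon_chord_def
  by (rule inner_segment_eq[OF _ inner_mid_endpoint]) auto

text \<open>Both ends of the inner chord lie strictly beyond the line that carries the outer one,
  and an open half plane is convex. The separated case is the same argument in the opposite half
  plane.\<close>

lemma chords_disjoint_nested:
  assumes "0 < g" "x < x'" "x' < y" "x < y'" "y' < y" "y < x + 4 * real g"
  shows "polygon_chord g (x, y) \<inter> polygon_chord g (x', y') = {}"
proof -
  have "z \<bullet> polygon_point g ((x + y) / 2) > cos (2 * pi * ((y - x) / 2) / (4 * real g))"
    if "z \<in> polygon_chord g (x', y')" for z
    using that unfolding polygon_chord_def
    by (rule inner_segment_gt; intro inner_mid_inside) (use assms in simp_all)
  then show ?thesis using chord_inner by fastforce
qed

lemma chords_disjoint_separate:
  assumes "0 < g" "x < y" "y < x'" "x' < y'" "y' < x + 4 * real g"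
  shows "polygon_chord g (x, y) \<inter> polygon_chord g (x', y') = {}"
proof -
  have "z \<bullet> polygon_point g ((x + y) / 2) < cos (2 * pi * ((y - x) / 2) / (4 * real g))"
    if "z \<in> polygon_chord g (x', y')" for z
    using that unfolding polygon_chord_def
    by (rule inner_segment_less; intro inner_mid_outside) (use assms in simp_all)
  then show ?thesis using chord_inner by fastforce
qed

text \<open>The ends of the second chord lie on opposite sides of the line through the first. The
  linear functional defining that line is therefore injective along the second chord.\<close>

lemma chords_cross_at_most_once:
  assumes "0 < g" "x < x'" "x' < y" "y < y'" "y' < x + 4 * real g"
    and z: "z \<in> polygon_chord g (x, y) \<inter> polygon_chord g (x', y')"
    and w: "w \<in> polygon_chord g (x, y) \<inter> polygon_chord g (x', y')"
  shows "z = w"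
proof -
  define c where "c = polygon_point g ((x + y) / 2)"
  define a where "a = polygon_point g x'"
  define b where "b = polygon_point g y'"
  have ne: "b \<bullet> c < a \<bullet> c"
    using inner_mid_inside[of g x x' y] inner_mid_outside[of g x y y'] assms
    unfolding a_def b_def c_def by linarith
  obtain s where s: "z = (1 - s) *\<^sub>R a + s *\<^sub>R b"
    using z by (auto simp: polygon_chord_def a_def b_def in_segment)
  obtain t where t: "w = (1 - t) *\<^sub>R a + t *\<^sub>R b"
    using w by (auto simp: polygon_chord_def a_def b_def in_segment)
  have "z \<bullet> c = w \<bullet> c"
    unfolding c_def using z w chord_inner by simp
  then have "(s - t) * (a \<bullet> c - b \<bullet> c) = 0"
    by (simp add: s t inner_left_distrib algebra_simps)
  then have "s = t" using ne by simp
  then show ?thesis by (simp add: s t)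
qed

lemma chord_subset_cball: "polygon_chord g c \<subseteq> cball 0 1"
  unfolding polygon_chord_def by (rule closed_segment_subset) auto

text \<open>Strict convexity of the disc: between two distinct points of the circle the norm drops
  below one.\<close>

lemma chord_boundary:
  assumes g: "0 < g" and xy: "x < y" "y < x + 4 * real g"
    and z: "z \<in> polygon_chord g (x, y)" "norm z = 1"
  shows "z = polygon_point g x \<or> z = polygon_point g y"
proof (rule ccontr)
  assume c: "\<not> ?thesis"
  have "polygon_point g x \<noteq> polygon_point g y"
    using polygon_point_inj[of g x y] assms by auto
  moreover have "z \<in> open_segment (polygon_point g x) (polygon_point g y)"
    using z c by (auto simp: open_segment_def polygon_chord_def)
  ultimately have "norm z < 1"
    using dist_decreases_open_segment[of z "polygon_point g x" "polygon_point g y" 0]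
    by auto
  then show False using z by simp
qed

section \<open>The gluing\<close>

definition polygon_vertex :: "nat \<Rightarrow> complex \<Rightarrow> bool" where
  "polygon_vertex g x \<longleftrightarrow> (\<exists>i::int. x = polygon_point g (of_int i))"

lemma polygon_vertexI: "t \<in> \<int> \<Longrightarrow> polygon_vertex g (polygon_point g t)"
  by (auto simp: polygon_vertex_def elim: Ints_cases)

lemma polygon_vertex_iff:
  assumes "0 < g"
  shows "polygon_vertex g (polygon_point g t) \<longleftrightarrow> t \<in> \<int>"
proof
  assume "polygon_vertex g (polygon_point g t)"
  then obtain i n :: int where "t = of_int i + 4 * real g * of_int n"
    using assms by (auto simp: polygon_vertex_def polygon_point_eq_iff)
  then have "t = of_int (i + 4 * int g * n)" by simp
  then show "t \<in> \<int>" by simp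
qed (rule polygon_vertexI)

lemma finite_polygon_vertices:
  assumes "0 < g"
  shows "finite {x. polygon_vertex g x}"
proof (rule finite_subset)
  show "{x. polygon_vertex g x} \<subseteq> (\<lambda>i. polygon_point g (of_int i)) ` {0..<4 * int g}"
  proof clarify
    fix x assume "polygon_vertex g x"
    then obtain i where x: "x = polygon_point g (of_int i)"
      by (auto simp: polygon_vertex_def)
    have "real_of_int i = of_int (i mod (4 * int g)) + 4 * real g * of_int (i div (4 * int g))"
      using arg_cong[OF mod_mult_div_eq[of i "4 * int g", symmetric], of real_of_int]
      by (simp only: of_int_add of_int_mult of_int_of_nat_eq of_int_numeral)
    then have "x = polygon_point g (of_int (i mod (4 * int g)))"
      unfolding x polygon_point_eq_iff[OF assms] by (rule exI)
    then show "x \<in> (\<lambda>i. polygon_point g (of_int i)) ` {0..<4 * int g}"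
      using assms by (intro image_eqI[where x = "i mod (4 * int g)"]) simp_all
  qed
qed simp

lemma side_param_unique:
  assumes g: "0 < g" and "a < 4 * g" "b < 4 * g" "0 \<le> s" "s \<le> 1" "0 \<le> t" "t \<le> 1"
    and eq: "polygon_point g (real a + s) = polygon_point g (real b + t)"
    and nv: "\<not> polygon_vertex g (polygon_point g (real a + s))"
  shows "a = b \<and> s = t"
proof -
  have "real a + s \<notin> \<int>" "real b + t \<notin> \<int>"
    using nv eq g by (metis polygon_vertexI)+
  then have "s \<noteq> 0" "s \<noteq> 1" "t \<noteq> 0" "t \<noteq> 1"
    by auto
  then have st: "0 < s" "s < 1" "0 < t" "t < 1" using assms by auto
  have "real a + 1 \<le> 4 * real g" "real b + 1 \<le> 4 * real g"
    using assms by (simp_all flip: of_nat_Suc add: field_simps)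
  then have "real a + s = real b + t"
    using st by (intro polygon_point_inj[OF g eq]) linarith
  then have "real_of_int (int a - int b) = t - s" by simp
  then have "\<bar>real_of_int (int a - int b)\<bar> < 1" using st by linarith
  then have "\<bar>int a - int b\<bar> < 1" by linarith
  then have "a = b" by linarith
  then show ?thesis using \<open>real a + s = real b + t\<close> by simp
qed

lemma side_pairingE:
  assumes "side_pairing g x y"
  obtains j s where "j < 4 * g" "j + 2 < 4 * g" "j mod 4 \<in> {0, 1}" "(j + 2) mod 4 \<in> {2, 3}"
    "0 \<le> s" "s \<le> 1" "x = polygon_point g (real j + s)" "y = polygon_point g (real (j + 2) + (1 - s))"
proof -
  obtain j s where j: "j < 4 * g" "j mod 4 \<in> {0, 1}" "0 \<le> s" "s \<le> 1"
    "x = polygon_point g (real j + s)" "y = polygon_point g (real j + 3 - s)"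
    using assms by (auto simp: side_pairing_def)
  moreover have "j + 2 < 4 * g" "(j + 2) mod 4 \<in> {2, 3}"
    using j(1,2) by (simp_all only: insert_iff empty_iff) presburger+
  moreover have "real j + 3 - s = real (j + 2) + (1 - s)" by simp
  ultimately show ?thesis using that by metis
qed

lemma side_pairing_vertex:
  assumes g: "0 < g" and "side_pairing g x y"
  shows "polygon_vertex g x \<longleftrightarrow> polygon_vertex g y"
  using assms(2)
proof (rule side_pairingE)
  fix j s assume x: "x = polygon_point g (real j + s)" and y: "y = polygon_point g (real (j + 2) + (1 - s))"
  have "real j + s \<in> \<int> \<longleftrightarrow> real (j + 2) + (1 - s) \<in> \<int>"
  proof
    assume "real j + s \<in> \<int>"
    then have "of_nat (2 * j + 3) - (real j + s) \<in> \<int>" by (intro Ints_diff) auto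
    then show "real (j + 2) + (1 - s) \<in> \<int>" by simp
  next
    assume "real (j + 2) + (1 - s) \<in> \<int>"
    then have "of_nat (2 * j + 3) - (real (j + 2) + (1 - s)) \<in> \<int>" by (intro Ints_diff) auto
    then show "real j + s \<in> \<int>" by simp
  qed
  then show ?thesis using g by (simp add: x y polygon_vertex_iff)
qed

lemma side_pairing_unique_right:
  assumes g: "0 < g" and "side_pairing g x y" "side_pairing g x z" "\<not> polygon_vertex g x"
  shows "y = z"
proof -
  obtain j s where j: "j < 4 * g" "0 \<le> s" "s \<le> 1" "x = polygon_point g (real j + s)"
      "y = polygon_point g (real (j + 2) + (1 - s))"
    using assms(2) by (rule side_pairingE)
  obtain i t where i: "i < 4 * g" "0 \<le> t" "t \<le> 1" "x = polygon_point g (real i + t)"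
      "z = polygon_point g (real (i + 2) + (1 - t))"
    using assms(3) by (rule side_pairingE)
  have "j = i \<and> s = t"
    using j i assms by (intro side_param_unique) auto
  then show ?thesis using i j by simp
qed

lemma side_pairing_unique_left:
  assumes g: "0 < g" and "side_pairing g x y" "side_pairing g z y" "\<not> polygon_vertex g y"
  shows "x = z"
proof -
  obtain j s where j: "j + 2 < 4 * g" "0 \<le> s" "s \<le> 1" "x = polygon_point g (real j + s)"
      "y = polygon_point g (real (j + 2) + (1 - s))"
    using assms(2) by (rule side_pairingE)
  obtain i t where i: "i + 2 < 4 * g" "0 \<le> t" "t \<le> 1" "z = polygon_point g (real i + t)"
      "y = polygon_point g (real (i + 2) + (1 - t))"
    using assms(3) by (rule side_pairingE)
  have "j + 2 = i + 2 \<and> 1 - s = 1 - t"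
    using j i assms by (intro side_param_unique) auto
  then show ?thesis using i j by simp
qed

text \<open>First components lie on sides congruent to 0 or 1 modulo 4, second components on sides
  congruent to 2 or 3; only vertices belong to sides of both kinds.\<close>

lemma side_pairing_not_composable:
  assumes g: "0 < g" and "side_pairing g x y" "side_pairing g y z"
  shows "polygon_vertex g y"
proof (rule ccontr)
  assume nv: "\<not> ?thesis"
  obtain j s where j: "j + 2 < 4 * g" "(j + 2) mod 4 \<in> {2, 3}" "0 \<le> s" "s \<le> 1"
      "y = polygon_point g (real (j + 2) + (1 - s))"
    using assms(2) by (rule side_pairingE)
  obtain i t where i: "i < 4 * g" "i mod 4 \<in> {0, 1}" "0 \<le> t" "t \<le> 1" "y = polygon_point g (real i + t)"
    using assms(3) by (rule side_pairingE)
  have "j + 2 = i \<and> 1 - s = t"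
    using j i nv g by (intro side_param_unique) auto
  then show False using i(2) j(2) by auto
qed

text \<open>Away from the vertices a zigzag of pairings collapses: consecutive steps in opposite
  directions cancel because partners are unique, and steps in the same direction do not compose.
  Once a vertex is reached, every further point is a vertex too.\<close>

lemma surface_rel_cases:
  assumes g: "0 < g" and "(x, y) \<in> surface_rel g"
  shows "x = y \<or> side_pairing g x y \<or> side_pairing g y x \<or> (polygon_vertex g x \<and> polygon_vertex g y)"
proof -
  have "equivclp (side_pairing g) x y" using assms(2) by (simp add: surface_rel_def)
  then show ?thesis
  proof (induction rule: equivclp_induct)
    case (step y z)
    then show ?case
      using side_pairing_vertex[OF g] side_pairing_unique_right[OF g] side_pairing_unique_left[OF g]
        side_pairing_not_composable[OF g] by metis
  qed simp
qed

lemma side_pairing_norm: "side_pairing g x y \<Longrightarrow> norm x = 1 \<and> norm y = 1"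
  by (auto simp: side_pairing_def)

lemma side_pairing_rel: "side_pairing g x y \<Longrightarrow> (x, y) \<in> surface_rel g"
  using side_pairing_norm[of g x y] by (auto simp: surface_rel_def)

section \<open>The projection to the surface and the Hausdorff property\<close>

definition surface_proj :: "nat \<Rightarrow> complex \<Rightarrow> complex set" where
  "surface_proj g x = surface_rel g `` {x}"

lemma surface_proj_eq_iff:
  assumes "norm x \<le> 1" "norm y \<le> 1"
  shows "surface_proj g x = surface_proj g y \<longleftrightarrow> (x, y) \<in> surface_rel g"
  unfolding surface_proj_def using eq_equiv_class_iff[OF equiv_surface_rel, of x y g] assms by simp

lemma surface_proj_pairing: "side_pairing g x y \<Longrightarrow> surface_proj g x = surface_proj g y"
  using side_pairing_norm[of g x y] side_pairing_rel[of g x y] surface_proj_eq_iff[of x y g] by simp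

lemma quotient_map_surface_proj: "quotient_map (top_of_set (cball 0 1)) (genus_surface g) (surface_proj g)"
  using quotient_map_genus_surface unfolding surface_proj_def .

lemma continuous_map_surface_proj:
  "continuous_map (top_of_set (cball 0 1)) (genus_surface g) (surface_proj g)"
  by (rule quotient_imp_continuous_map[OF quotient_map_surface_proj])

lemma topspace_genus_surface_proj: "topspace (genus_surface g) = surface_proj g ` cball 0 1"
  using quotient_imp_surjective_map[OF quotient_map_surface_proj] by simp

lemma continuous_polygon_point: "continuous_on S (\<lambda>s. polygon_point g (f s))" if "continuous_on S f"
  unfolding polygon_point_def divide_inverse by (intro continuous_intros that)

text \<open>The saturation consists of \<open>C\<close>, the partners of its boundary points in both
  directions, and some vertices. The partners form finitely many compact images, and there are only
  finitely many vertices.\<close>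

lemma closed_saturation:
  assumes g: "0 < g" and C: "closed C" "C \<subseteq> cball 0 1"
  shows "closed {x \<in> cball 0 1. surface_proj g x \<in> surface_proj g ` C}" (is "closed ?S")
proof -
  define J where "J = {j. j < 4 * g \<and> j mod 4 \<in> {0, 1}}"
  \<comment> \<open>One construction serves both directions of the pairing; exchanging
    \<open>f\<close> and \<open>h\<close> exchanges the two partners.\<close>
  define P where "P f h = (\<Union>j\<in>J. (\<lambda>s. polygon_point g (h j s)) ` {s \<in> {0..1}. polygon_point g (f j s) \<in> C})"
    for f h :: "nat \<Rightarrow> real \<Rightarrow> real"
  have P: "closed (P f h)" if "\<And>j. continuous_on {0..1} (f j)" "\<And>j. continuous_on {0..1} (h j)" for f h
    unfolding P_def
  proof (intro closed_UN ballI)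
    show "finite J" by (simp add: J_def)
    fix j assume "j \<in> J"
    have "closed ({0..1} \<inter> (\<lambda>s. polygon_point g (f j s)) -` C)"
      by (intro continuous_closed_preimage continuous_polygon_point that C) auto
    then have "compact ({0..1} \<inter> ({0..1} \<inter> (\<lambda>s. polygon_point g (f j s)) -` C))"
      by (intro compact_Int_closed) auto
    also have "{0..1} \<inter> ({0..1} \<inter> (\<lambda>s. polygon_point g (f j s)) -` C) =
        {s \<in> {0..1}. polygon_point g (f j s) \<in> C}"
      by auto
    finally have "compact {s \<in> {0..1}. polygon_point g (f j s) \<in> C}" .
    then show "closed ((\<lambda>s. polygon_point g (h j s)) ` {s \<in> {0..1}. polygon_point g (f j s) \<in> C})"
      by (intro compact_imp_closed compact_continuous_image)
        (auto intro!: continuous_polygon_point continuous_on_subset[OF that(2)])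
  qed
  define P1 where "P1 = P (\<lambda>j s. real j + s) (\<lambda>j s. real j + 3 - s)"
  define P2 where "P2 = P (\<lambda>j s. real j + 3 - s) (\<lambda>j s. real j + s)"
  have sp: "side_pairing g x y \<longleftrightarrow>
      (\<exists>j\<in>J. \<exists>s\<in>{0..1}. x = polygon_point g (real j + s) \<and> y = polygon_point g (real j + 3 - s))" for x y
    by (simp add: side_pairing_def J_def Bex_def conj_assoc)
  have swap: "(\<Union>j\<in>J. h j ` {s \<in> I. f j s \<in> C}) = {y. \<exists>x\<in>C. \<exists>j\<in>J. \<exists>s\<in>I. x = f j s \<and> y = h j s}"
    for f h :: "nat \<Rightarrow> real \<Rightarrow> complex" and I
    by blast
  have P1: "P1 = {y. \<exists>x\<in>C. side_pairing g x y}"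
    unfolding P1_def P_def sp swap ..
  have P2: "P2 = {y. \<exists>x\<in>C. side_pairing g y x}"
    unfolding P2_def P_def sp swap by (simp only: conj_commute)
  have "?S = C \<union> P1 \<union> P2 \<union> (?S \<inter> {x. polygon_vertex g x})"
  proof (intro equalityI subsetI)
    fix y assume y: "y \<in> ?S"
    then obtain x where x: "x \<in> C" "surface_proj g x = surface_proj g y"
      by (auto elim!: imageE)
    then have "(x, y) \<in> surface_rel g"
      using C y surface_proj_eq_iff[of x y g] by (simp add: subset_iff)
    from surface_rel_cases[OF g this] show "y \<in> C \<union> P1 \<union> P2 \<union> (?S \<inter> {x. polygon_vertex g x})"
      using x y P1 P2 by blast
  next
    fix y assume y: "y \<in> C \<union> P1 \<union> P2 \<union> (?S \<inter> {x. polygon_vertex g x})"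
    have "y \<in> ?S" if 1: "y \<in> P1"
    proof -
      obtain x where "x \<in> C" "side_pairing g x y" using 1 P1 by blast
      then show ?thesis using side_pairing_norm[of g x y] surface_proj_pairing[of g x y] by auto
    qed
    moreover have "y \<in> ?S" if 2: "y \<in> P2"
    proof -
      obtain x where "x \<in> C" "side_pairing g y x" using 2 P2 by blast
      then show ?thesis using side_pairing_norm[of g y x] surface_proj_pairing[of g y x] by auto
    qed
    ultimately show "y \<in> ?S" using y C by blast
  qed
  moreover have "closed (C \<union> P1 \<union> P2 \<union> (?S \<inter> {x. polygon_vertex g x}))"
  proof (intro closed_Un)
    show "closed (?S \<inter> {x. polygon_vertex g x})"
      using finite_polygon_vertices[OF g] by (intro finite_imp_closed) simp
  qed (auto simp: P1_def P2_def C intro!: P continuous_intros)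
  ultimately show ?thesis by simp
qed

lemma closed_map_surface_proj:
  assumes "0 < g"
  shows "closed_map (top_of_set (cball 0 1)) (genus_surface g) (surface_proj g)"
  unfolding closed_map_def
proof (intro allI impI)
  fix C assume *: "closedin (top_of_set (cball (0::complex) 1)) C"
  then have C: "closed C" "C \<subseteq> cball 0 1"
    by (rule closedin_closed_trans[OF _ closed_cball]) (use * in \<open>simp add: closedin_def\<close>)
  have "closedin (top_of_set (cball 0 1)) {x \<in> topspace (top_of_set (cball 0 1)). surface_proj g x \<in> surface_proj g ` C}"
    using closed_saturation[OF assms C] by (auto intro: closed_subset)
  moreover have "surface_proj g ` C \<subseteq> topspace (genus_surface g)"
    using C(2) topspace_genus_surface_proj by blast
  ultimately show "closedin (genus_surface g) (surface_proj g ` C)"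
    using quotient_map_surface_proj[of g] unfolding quotient_map_closedin by blast
qed

text \<open>Closed continuous images of normal Hausdorff spaces are again such, and the disc is
  metrizable. The property is used twice later: loops are closed subsets, and a parametrisation of a
  simple loop is a homeomorphism onto it.\<close>

lemma Hausdorff_genus_surface:
  assumes "0 < g"
  shows "Hausdorff_space (genus_surface g)"
proof -
  have "metrizable_space (top_of_set (cball (0::complex) 1))"
    by (simp add: metrizable_space_subtopology metrizable_space_euclidean)
  then have "normal_space (top_of_set (cball (0::complex) 1))" "Hausdorff_space (top_of_set (cball (0::complex) 1))"
    by (simp_all add: metrizable_imp_normal_space metrizable_imp_Hausdorff_space)
  moreover have "surface_proj g ` topspace (top_of_set (cball 0 1)) = topspace (genus_surface g)"
    by (simp add: topspace_genus_surface_proj)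
  ultimately show ?thesis
    using normal_Hausdorff_space_closed_continuous_map_image closed_map_surface_proj[OF assms]
      continuous_map_surface_proj by blast
qed

section \<open>Loops made of chords\<close>

text \<open>
  A crossing \<open>(a, \<kappa>)\<close> is a passage through the side \<open>a\<close> of the polygon: the loop arrives at the
  boundary parameter \<open>a + \<kappa>\<close> and reappears at \<open>a + 3 - \<kappa>\<close>. A list of crossings that occupy
  disjoint intervals in increasing order describes a loop whose chords are the gaps between
  these intervals, the last gap being closed up by adding the period \<open>4 * g\<close>.
\<close>

definition crossing_in :: "nat \<times> real \<Rightarrow> real" where
  "crossing_in c = real (fst c) + snd c"

definition crossing_out :: "nat \<times> real \<Rightarrow> real" where
  "crossing_out c = real (fst c) + 3 - snd c"

definition is_crossing :: "nat \<Rightarrow> nat \<times> real \<Rightarrow> bool" where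
  "is_crossing g c \<longleftrightarrow> fst c < 4 * g \<and> fst c mod 4 \<in> {0, 1} \<and> 0 < snd c \<and> snd c < 1"

definition crossing_list :: "nat \<Rightarrow> (nat \<times> real) list \<Rightarrow> bool" where
  "crossing_list g cs \<longleftrightarrow> cs \<noteq> [] \<and> (\<forall>c\<in>set cs. is_crossing g c) \<and>
     sorted_wrt (\<lambda>c c'. crossing_out c < crossing_in c') cs"

definition loop_chord :: "nat \<Rightarrow> (nat \<times> real) list \<Rightarrow> nat \<Rightarrow> real \<times> real" where
  "loop_chord g cs t = (crossing_out (cs ! t),
     if Suc t < length cs then crossing_in (cs ! Suc t) else 4 * real g + crossing_in (cs ! 0))"

definition crossing_loop :: "nat \<Rightarrow> (nat \<times> real) list \<Rightarrow> complex set set" where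
  "crossing_loop g cs = (\<Union>t<length cs. surface_proj g ` polygon_chord g (loop_chord g cs t))"

lemma is_crossing_bounds:
  assumes "is_crossing g c"
  shows "0 < g" "0 < crossing_in c" "crossing_in c < crossing_out c" "crossing_out c < 4 * real g"
proof -
  have "fst c + 2 < 4 * g"
    using assms by (auto simp: is_crossing_def) presburger
  then have "real (fst c) + 3 \<le> 4 * real g" by linarith
  then show "0 < g" "0 < crossing_in c" "crossing_in c < crossing_out c" "crossing_out c < 4 * real g"
    using assms by (auto simp: is_crossing_def crossing_in_def crossing_out_def)
qed

lemma crossing_pairing:
  assumes "is_crossing g c"
  shows "side_pairing g (polygon_point g (crossing_in c)) (polygon_point g (crossing_out c))"
  using assms unfolding side_pairing_def is_crossing_def crossing_in_def crossing_out_def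
  by (intro exI[of _ "fst c"] exI[of _ "snd c"]) auto

lemma crossing_not_vertex:
  assumes "is_crossing g c"
  shows "\<not> polygon_vertex g (polygon_point g (crossing_in c))"
    "\<not> polygon_vertex g (polygon_point g (crossing_out c))"
proof -
  have g: "0 < g" using is_crossing_bounds[OF assms] by simp
  have "crossing_in c \<notin> \<int>"
  proof
    assume "crossing_in c \<in> \<int>"
    then obtain i :: int where "crossing_in c = of_int i"
      by (auto elim: Ints_cases)
    then have "real (fst c) + snd c = of_int i" by (simp add: crossing_in_def)
    then have "snd c = of_int (i - int (fst c))" by simp
    moreover have "0 < snd c" "snd c < 1" using assms by (auto simp: is_crossing_def)
    ultimately have "0 < i - int (fst c)" "i - int (fst c) < 1"
      by (simp_all only: of_int_0_less_iff of_int_less_1_iff)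
    then show False by simp
  qed
  then show *: "\<not> polygon_vertex g (polygon_point g (crossing_in c))"
    using g by (simp add: polygon_vertex_iff)
  then show "\<not> polygon_vertex g (polygon_point g (crossing_out c))"
    using side_pairing_vertex[OF g crossing_pairing[OF assms]] by simp
qed

section \<open>Fibres of the projection over a loop\<close>

lemma surface_proj_crossing:
  "is_crossing g c \<Longrightarrow>
    surface_proj g (polygon_point g (crossing_out c)) = surface_proj g (polygon_point g (crossing_in c))"
  using surface_proj_pairing[OF crossing_pairing] by simp

lemma surface_proj_eq_crossing:
  assumes c: "is_crossing g c" and z: "norm z \<le> 1"
    and eq: "surface_proj g z = surface_proj g (polygon_point g (crossing_in c))"
  shows "z = polygon_point g (crossing_in c) \<or> z = polygon_point g (crossing_out c)"
proof -
  have g: "0 < g" using is_crossing_bounds[OF c] by simp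
  have "(z, polygon_point g (crossing_in c)) \<in> surface_rel g"
    using eq z surface_proj_eq_iff[of z "polygon_point g (crossing_in c)" g] by simp
  from surface_rel_cases[OF g this] show ?thesis
    using side_pairing_not_composable[OF g _ crossing_pairing[OF c]] crossing_not_vertex[OF c]
      side_pairing_unique_right[OF g _ crossing_pairing[OF c]] by blast
qed

text \<open>The two preimages of a crossing point lie on sides of different residues modulo 4, so
  the arrival point is determined, and with it the side and the parameter.\<close>

lemma crossing_unique:
  assumes c: "is_crossing g c" and d: "is_crossing g d"
    and eq: "surface_proj g (polygon_point g (crossing_in c)) = surface_proj g (polygon_point g (crossing_in d))"
  shows "c = d"
proof -
  have g: "0 < g" using is_crossing_bounds[OF c] by simp
  have "polygon_point g (crossing_in c) \<noteq> polygon_point g (crossing_out d)"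
    using side_pairing_not_composable[OF g crossing_pairing[OF d]] crossing_pairing[OF c]
      crossing_not_vertex[OF d] by metis
  then have "polygon_point g (crossing_in c) = polygon_point g (crossing_in d)"
    using surface_proj_eq_crossing[OF d _ eq] by simp
  then have "fst c = fst d \<and> snd c = snd d"
    using c d crossing_not_vertex[OF c] g unfolding crossing_in_def is_crossing_def
    by (intro side_param_unique) auto
  then show ?thesis by (simp add: prod_eq_iff)
qed

lemma surface_proj_interior:
  assumes "0 < g" "norm z < 1" "norm w \<le> 1" "surface_proj g z = surface_proj g w"
  shows "z = w"
proof -
  have "(z, w) \<in> surface_rel g"
    using assms surface_proj_eq_iff[of z w g] by simp
  from surface_rel_cases[OF assms(1) this] show ?thesis
    using assms(2) side_pairing_norm[of g z w] side_pairing_norm[of g w z] by (auto simp: polygon_vertex_def)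
qed

lemma crossing_list_nth: "crossing_list g cs \<Longrightarrow> t < length cs \<Longrightarrow> is_crossing g (cs ! t)"
  by (simp add: crossing_list_def)

lemma crossing_list_pos: "crossing_list g cs \<Longrightarrow> 0 < g \<and> 0 < length cs"
  using is_crossing_bounds(1) by (fastforce simp: crossing_list_def neq_Nil_conv)

lemma crossing_list_less:
  "crossing_list g cs \<Longrightarrow> s < t \<Longrightarrow> t < length cs \<Longrightarrow> crossing_out (cs ! s) < crossing_in (cs ! t)"
  by (simp add: crossing_list_def sorted_wrt_iff_nth_less)

text \<open>The closing chord ends one period later, yet before chord \<open>0\<close> would start
  again. All chords thus fit into one period and can be compared as intervals of the real
  line.\<close>

lemma loop_chord_less:
  assumes cs: "crossing_list g cs" and t: "t < length cs"
  shows "fst (loop_chord g cs t) < snd (loop_chord g cs t)"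
    and "snd (loop_chord g cs t) < fst (loop_chord g cs 0) + 4 * real g"
proof -
  have "0 < length cs" "0 < g" using crossing_list_pos[OF cs] by auto
  note b = is_crossing_bounds[OF crossing_list_nth[OF cs]]
  show "fst (loop_chord g cs t) < snd (loop_chord g cs t)"
    using b[OF t] b[OF \<open>0 < length cs\<close>] crossing_list_less[OF cs, of t "Suc t"]
    by (auto simp: loop_chord_def)
  show "snd (loop_chord g cs t) < fst (loop_chord g cs 0) + 4 * real g"
    using b[of "Suc t"] b[OF \<open>0 < length cs\<close>] by (auto simp: loop_chord_def)
qed

lemma loop_chord_fst_mono:
  assumes cs: "crossing_list g cs" and "s < t" "t < length cs"
  shows "fst (loop_chord g cs s) < fst (loop_chord g cs t)"
  using crossing_list_less[OF cs assms(2,3)] is_crossing_bounds(3)[OF crossing_list_nth[OF cs assms(3)]]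
  by (simp add: loop_chord_def)

lemma loop_chord_width:
  assumes cs: "crossing_list g cs" and t: "t < length cs"
  shows "snd (loop_chord g cs t) < fst (loop_chord g cs t) + 4 * real g"
  using loop_chord_less(2)[OF cs t] loop_chord_fst_mono[OF cs, of 0 t] t by (cases "t = 0") auto

lemma loop_chord_sep:
  assumes cs: "crossing_list g cs" and st: "s < t" "t < length cs"
  shows "snd (loop_chord g cs s) < fst (loop_chord g cs t)"
proof -
  have s: "Suc s < length cs" using st by simp
  have "crossing_in (cs ! Suc s) < crossing_out (cs ! Suc s)"
    using is_crossing_bounds(3)[OF crossing_list_nth[OF cs s]] .
  also have "\<dots> \<le> crossing_out (cs ! t)"
    using loop_chord_fst_mono[OF cs, of "Suc s" t] st by (cases "t = Suc s") (auto simp: loop_chord_def)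
  finally show ?thesis using s by (simp add: loop_chord_def)
qed

lemma loop_chords_disjoint:
  assumes cs: "crossing_list g cs" and "s < length cs" "t < length cs"
    and z: "z \<in> polygon_chord g (loop_chord g cs s)" "z \<in> polygon_chord g (loop_chord g cs t)"
  shows "s = t"
proof -
  have *: "polygon_chord g (loop_chord g cs s) \<inter> polygon_chord g (loop_chord g cs t) = {}"
    if st: "s < t" "t < length cs" for s t
  proof -
    have "0 < g" using crossing_list_pos[OF cs] by simp
    moreover have "snd (loop_chord g cs t) < fst (loop_chord g cs s) + 4 * real g"
      using loop_chord_less(2)[OF cs st(2)] loop_chord_fst_mono[OF cs, of 0 s] st by (cases "s = 0") auto
    moreover have "s < length cs" using st by simp
    ultimately show ?thesis
      using chords_disjoint_separate[of g "fst (loop_chord g cs s)" "snd (loop_chord g cs s)"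
          "fst (loop_chord g cs t)" "snd (loop_chord g cs t)"]
        loop_chord_less(1)[OF cs] loop_chord_sep[OF cs st] st by simp
  qed
  show ?thesis using *[of s t] *[of t s] assms by (metis IntI empty_iff linorder_neqE_nat)
qed

lemma loop_chord_boundary:
  assumes cs: "crossing_list g cs" and t: "t < length cs"
    and z: "z \<in> polygon_chord g (loop_chord g cs t)" "norm z = 1"
  shows "z = polygon_point g (fst (loop_chord g cs t)) \<or> z = polygon_point g (snd (loop_chord g cs t))"
  using chord_boundary[of g "fst (loop_chord g cs t)" "snd (loop_chord g cs t)" z]
    crossing_list_pos[OF cs] loop_chord_less(1)[OF cs t] loop_chord_width[OF cs t] z by simp

lemma loop_chord_snd:
  assumes cs: "crossing_list g cs" and t: "t < length cs"
  shows "polygon_point g (snd (loop_chord g cs t)) = polygon_point g (crossing_in (cs ! (Suc t mod length cs)))"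
proof (cases "Suc t < length cs")
  case False
  then have "Suc t = length cs" using t by simp
  then show ?thesis using crossing_list_pos[OF cs] by (simp add: loop_chord_def)
qed (simp add: loop_chord_def)

text \<open>A case rule for comparing points on the surface: at interior points the projection is
  injective, and the only boundary points of a loop are its crossings.\<close>

lemma chord_point_cases:
  assumes cs: "crossing_list g cs" and t: "t < length cs"
    and z: "z \<in> polygon_chord g (loop_chord g cs t)"
  obtains (interior) "norm z < 1"
    | (boundary) c where "c \<in> set cs" "surface_proj g z = surface_proj g (polygon_point g (crossing_in c))"
proof -
  have "norm z \<le> 1" using z chord_subset_cball by fastforce
  moreover have "\<exists>c\<in>set cs. surface_proj g z = surface_proj g (polygon_point g (crossing_in c))" if "norm z = 1"
  proof -
    have "surface_proj g (polygon_point g (fst (loop_chord g cs t))) = surface_proj g (polygon_point g (crossing_in (cs ! t)))"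
      using surface_proj_crossing[OF crossing_list_nth[OF cs t]] by (simp add: loop_chord_def)
    moreover have "Suc t mod length cs < length cs" using t by (intro mod_less_divisor) linarith
    ultimately show ?thesis
      using loop_chord_boundary[OF cs t z that] loop_chord_snd[OF cs t] t nth_mem by metis
  qed
  ultimately show ?thesis using interior boundary by fastforce
qed

text \<open>A common point has equal lifts as soon as one lift is interior. If both lifts lie on the
  boundary, the loops share a crossing, which \<open>dis\<close> forbids.\<close>

lemma crossing_loop_Int:
  assumes cs: "crossing_list g cs" and ds: "crossing_list g ds" and dis: "set cs \<inter> set ds = {}"
  shows "crossing_loop g cs \<inter> crossing_loop g ds \<subseteq>
    (\<Union>s<length cs. \<Union>t<length ds. surface_proj g `
       (polygon_chord g (loop_chord g cs s) \<inter> polygon_chord g (loop_chord g ds t)))"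
proof
  fix x assume "x \<in> crossing_loop g cs \<inter> crossing_loop g ds"
  then obtain s t z w where st: "s < length cs" "t < length ds"
    and z: "z \<in> polygon_chord g (loop_chord g cs s)" "x = surface_proj g z"
    and w: "w \<in> polygon_chord g (loop_chord g ds t)" "x = surface_proj g w"
    unfolding crossing_loop_def by auto
  have g: "0 < g" using crossing_list_pos[OF cs] by simp
  have n: "norm z \<le> 1" "norm w \<le> 1" using z w chord_subset_cball by fastforce+
  have eq: "surface_proj g z = surface_proj g w" using z w by simp
  have "z = w"
    using cs st(1) z(1)
  proof (cases rule: chord_point_cases)
    case interior
    then show ?thesis using surface_proj_interior[OF g _ n(2) eq] by simp
  next
    case c: (boundary c)
    show ?thesis
      using ds st(2) w(1)
    proof (cases rule: chord_point_cases)
      case interior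
      then show ?thesis using surface_proj_interior[OF g _ n(1) eq[symmetric]] by simp
    next
      case d: (boundary d)
      have "c = d" using crossing_unique[of g c d] c d eq cs ds by (auto simp: crossing_list_def)
      then show ?thesis using c d dis by blast
    qed
  qed
  then show "x \<in> (\<Union>s<length cs. \<Union>t<length ds. surface_proj g `
       (polygon_chord g (loop_chord g cs s) \<inter> polygon_chord g (loop_chord g ds t)))"
    using z w st by blast
qed

text \<open>The map \<open>e\<close> wraps the interval around the circle. It is a quotient map,
  since the interval is compact and the circle Hausdorff, and it identifies nothing but the two
  ends; hence \<open>q\<close> factors through it.\<close>

lemma simple_loop_from_interval:
  fixes q :: "real \<Rightarrow> 'a"
  assumes b: "0 < b" and q: "continuous_map (top_of_set {0..b}) X q" "q 0 = q b" "inj_on q {0..<b}"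
  shows "simple_loop X (q ` {0..b})"
proof -
  define e where "e x = cis (2 * pi * x / b)" for x
  have e_eq: "e x = e y \<longleftrightarrow> (\<exists>n::int. x = y + b * n)" for x y
  proof -
    have *: "x / D = y / D + z \<longleftrightarrow> x = y + D * z" if "D \<noteq> 0" for x y z D :: real
      using that by (auto simp: field_simps)
    have "e x = e y \<longleftrightarrow> (\<exists>n::int. 2 * pi * x / b = 2 * pi * y / b + 2 * pi * n)"
      using sin_cos_eq_iff[of "2 * pi * x / b" "2 * pi * y / b"]
      by (auto simp: e_def complex_eq_iff)
    also have "\<dots> \<longleftrightarrow> (\<exists>n::int. x = y + b * n)"
    proof (rule ex_cong1)
      fix n :: int
      show "(2 * pi * x / b = 2 * pi * y / b + 2 * pi * n) = (x = y + b * n)"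
      proof -
        have "(2 * pi * x = 2 * pi * y + b * (2 * pi * n)) = (2 * pi * x = 2 * pi * (y + b * n))"
          by (simp add: algebra_simps)
        then show ?thesis using b *[of b "2 * pi * x" "2 * pi * y" "2 * pi * n"] by simp
      qed
    qed
    finally show ?thesis .
  qed
  have e_cases: "x = y \<or> (x = 0 \<and> y = b) \<or> (x = b \<and> y = 0)"
    if eq: "e x = e y" and xy: "0 \<le> x" "x \<le> b" "0 \<le> y" "y \<le> b" for x y
  proof -
    obtain n :: int where n: "x = y + b * n" using iffD1[OF e_eq eq] ..
    then have "\<bar>b * of_int n\<bar> \<le> b" using xy by linarith
    then have "b * \<bar>of_int n\<bar> \<le> b * 1" using b by (simp add: abs_mult)
    then have "\<bar>n\<bar> \<le> 1" using b by (simp only: mult_le_cancel_left_pos)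
    then consider "n = 0" | "n = 1" | "n = -1" by linarith
    then show ?thesis using n xy by cases auto
  qed
  have surj: "\<exists>x\<in>{0..<b}. z = e x" if "z \<in> sphere 0 1" for z
  proof
    show "z = e (Arg2pi z * b / (2 * pi))"
      using that b Arg2pi_eq[of z] by (simp add: e_def cis_conv_exp)
    show "Arg2pi z * b / (2 * pi) \<in> {0..<b}"
      using b Arg2pi_lt_2pi[of z] Arg2pi_ge_0[of z] by (simp add: field_simps)
  qed
  have im: "e ` {0..b} = sphere 0 1"
  proof (intro equalityI subsetI)
    fix z :: complex assume "z \<in> sphere 0 1"
    then obtain x where "x \<in> {0..<b}" "z = e x" using surj by blast
    then show "z \<in> e ` {0..b}" by auto
  qed (auto simp: e_def)
  have "continuous_on {0..b} e"
    unfolding e_def divide_inverse by (intro continuous_intros)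
  then have quo: "quotient_map (top_of_set {0..b}) (top_of_set (sphere 0 1)) e"
    using im by (intro continuous_imp_quotient_map) (auto simp: compact_space_subtopology Hausdorff_space_subtopology)
  obtain p where p: "continuous_map (top_of_set (sphere 0 1)) X p"
      "\<And>x. x \<in> topspace (top_of_set {0..b}) \<Longrightarrow> p (e x) = q x"
  proof (rule quotient_map_lift_exists[OF quo q(1)])
    show "q x = q y" if "x \<in> topspace (top_of_set {0..b})" "y \<in> topspace (top_of_set {0..b})" "e x = e y" for x y
      using e_cases[of x y] that q(2) by auto
  qed metis
  have "inj_on p (sphere 0 1)"
  proof (rule inj_onI)
    fix z w assume zw: "z \<in> sphere 0 1" "w \<in> sphere 0 1" "p z = p w"
    then obtain x y where "x \<in> {0..<b}" "z = e x" "y \<in> {0..<b}" "w = e y"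
      using surj by meson
    then show "z = w" using q(3) p(2)[of x] p(2)[of y] zw by (simp add: inj_on_eq_iff)
  qed
  moreover have "p ` sphere 0 1 = q ` {0..b}"
    using p(2) by (auto simp: image_image simp flip: im)
  ultimately show ?thesis
    using p(1) unfolding simple_loop_def simple_loop_param_def by blast
qed

text \<open>Chord \<open>t\<close> is traversed on \<open>[t, t + 1]\<close>. The pieces agree at
  integers because the arrival and departure points of a crossing have the same image on the
  surface.\<close>

lemma simple_loop_crossing_loop:
  assumes cs: "crossing_list g cs"
  shows "simple_loop (genus_surface g) (crossing_loop g cs)"
proof -
  define N where "N = length cs"
  have N: "0 < N" and g: "0 < g" using crossing_list_pos[OF cs] by (auto simp: N_def)
  define P where "P t = polygon_point g (fst (loop_chord g cs t))" for t
  define Q where "Q t = polygon_point g (snd (loop_chord g cs t))" for t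
  define lin where "lin t x = (1 - (x - real t)) *\<^sub>R P t + (x - real t) *\<^sub>R Q t" for t x
  \<comment> \<open>The cap assigns the right end \<open>N\<close> of the parameter interval to the
    last chord.\<close>
  define ix where "ix x = min (nat \<lfloor>x\<rfloor>) (N - 1)" for x :: real
  define q where "q x = surface_proj g (lin (ix x) x)" for x
  have ix_less: "x < real (ix x) + 1" if "0 \<le> x" "x < real N" for x
  proof -
    have "\<lfloor>x\<rfloor> < int N" using that by (simp add: floor_less_iff)
    then have "ix x = nat \<lfloor>x\<rfloor>" by (auto simp: ix_def min_def)
    then show ?thesis using that by linarith
  qed
  have ix: "ix x < N" "real (ix x) \<le> x" "x \<le> real (ix x) + 1" if "0 \<le> x" "x \<le> real N" for x
  proof -
    show "ix x < N" using N by (auto simp: ix_def)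
    have "real (ix x) \<le> real (nat \<lfloor>x\<rfloor>)" by (simp add: ix_def)
    then show "real (ix x) \<le> x" using that by linarith
    show "x \<le> real (ix x) + 1"
    proof (cases "x = real N")
      case True
      then show ?thesis using N by (simp add: ix_def)
    qed (use that ix_less[of x] in simp)
  qed
  have lin_chord: "lin t ` {real t..real t + 1} = polygon_chord g (loop_chord g cs t)" for t
  proof -
    have "polygon_chord g (loop_chord g cs t) = (\<lambda>x. (1 - x) *\<^sub>R P t + x *\<^sub>R Q t) ` ((\<lambda>x. x - real t) ` {real t..real t + 1})"
      by (simp add: polygon_chord_def P_def Q_def closed_segment_image_interval)
    also have "\<dots> = lin t ` {real t..real t + 1}"
    proof -
      have "lin t = (\<lambda>x. (1 - (x - real t)) *\<^sub>R P t + (x - real t) *\<^sub>R Q t)"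
        by (simp add: lin_def fun_eq_iff)
      then show ?thesis by (simp only: image_image)
    qed
    finally show ?thesis by simp
  qed
  have glue: "surface_proj g (Q t) = surface_proj g (P (Suc t mod N))" if "t < N" for t
  proof -
    have "Suc t mod N < N" using N by simp
    then show ?thesis
      using loop_chord_snd[OF cs, of t] that surface_proj_crossing[OF crossing_list_nth[OF cs, of "Suc t mod N"]]
      by (simp add: P_def Q_def N_def loop_chord_def)
  qed
  have PQ: "P t \<noteq> Q t" if "t < N" for t
    using polygon_point_inj[OF g] loop_chord_less(1)[OF cs] loop_chord_width[OF cs] that
    unfolding P_def Q_def N_def by fastforce
  have lin_inj: "x = y" if "lin t x = lin t y" "t < N" for t x y
  proof -
    have "(x - y) *\<^sub>R (Q t - P t) = 0" using that(1) by (simp add: lin_def algebra_simps)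
    then show ?thesis using PQ[OF that(2)] by simp
  qed
  have cont: "continuous_map (top_of_set {0..real N}) (genus_surface g) q"
  proof (rule pasting_lemma_closed[where I = "{..<N}" and T = "\<lambda>t. {real t..real t + 1}"
        and f = "\<lambda>t x. surface_proj g (lin t x)"])
    show "closedin (top_of_set {0..real N}) {real t..real t + 1}" if "t \<in> {..<N}" for t
      using that by (intro closed_subset) auto
    show "continuous_map (subtopology (top_of_set {0..real N}) {real t..real t + 1}) (genus_surface g)
        (\<lambda>x. surface_proj g (lin t x))" if "t \<in> {..<N}" for t
    proof (rule continuous_map_compose[where g = "surface_proj g", unfolded o_def, OF _ continuous_map_surface_proj])
      have "continuous_on {real t..real t + 1} (lin t)"
        unfolding lin_def by (intro continuous_intros)
      moreover have "lin t ` {real t..real t + 1} \<subseteq> cball 0 1"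
        using lin_chord chord_subset_cball by metis
      ultimately show "continuous_map (subtopology (top_of_set {0..real N}) {real t..real t + 1}) (top_of_set (cball 0 1)) (lin t)"
        by (auto simp: subtopology_subtopology intro: continuous_on_subset)
    qed
    show "surface_proj g (lin i x) = surface_proj g (lin j x)"
      if ij: "i \<in> {..<N}" "j \<in> {..<N}" "x \<in> topspace (top_of_set {0..real N}) \<inter> {real i..real i + 1} \<inter> {real j..real j + 1}"
      for i j x
    proof -
      have *: "surface_proj g (lin i x) = surface_proj g (lin (Suc i) x)" if "Suc i < N" "x = real i + 1" for i
        using glue[of i] that by (simp add: lin_def)
      have "i = j \<or> (j = Suc i \<and> x = real i + 1) \<or> (i = Suc j \<and> x = real j + 1)"
        using ij by auto
      then show ?thesis using *[of i] *[of j] ij by auto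
    qed
    show "\<exists>j. j \<in> {..<N} \<and> x \<in> {real j..real j + 1} \<and> q x = surface_proj g (lin j x)"
      if "x \<in> topspace (top_of_set {0..real N})" for x
      using ix[of x] that by (intro exI[of _ "ix x"]) (auto simp: q_def)
  qed simp
  have "q 0 = q (real N)"
  proof -
    have "ix 0 = 0" "ix (real N) = N - 1" "Suc (N - 1) mod N = 0" "real N - real (N - 1) = 1"
      using N by (auto simp: ix_def of_nat_diff)
    then have "q 0 = surface_proj g (P 0)" "q (real N) = surface_proj g (Q (N - 1))"
      by (simp_all add: q_def lin_def)
    then show ?thesis using glue[of "N - 1"] N by simp
  qed
  moreover have "inj_on q {0..<real N}"
  proof (rule inj_onI)
    fix x y assume xy: "x \<in> {0..<real N}" "y \<in> {0..<real N}" "q x = q y"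
    define s t where "s = ix x" and "t = ix y"
    define z w where "z = lin s x" and "w = lin t y"
    have s: "s < N" "x \<in> {real s..<real s + 1}" and t: "t < N" "y \<in> {real t..<real t + 1}"
      using ix[of x] ix_less[of x] ix[of y] ix_less[of y] xy by (auto simp: s_def t_def)
    have eq: "surface_proj g z = surface_proj g w"
      using xy by (simp add: q_def z_def w_def s_def t_def)
    have zw: "z \<in> polygon_chord g (loop_chord g cs s)" "w \<in> polygon_chord g (loop_chord g cs t)"
      using s t by (auto simp: z_def w_def simp flip: lin_chord)
    \<comment> \<open>On a half-open parameter interval the start is the only boundary point of a
      chord, so each crossing is met at a single parameter.\<close>
    have start: "lin r u = polygon_point g (crossing_out (cs ! r))"
      if "norm (lin r u) = 1" "r < N" "u \<in> {real r..<real r + 1}" for r u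
    proof -
      have "lin r u \<in> polygon_chord g (loop_chord g cs r)"
        using that by (auto simp flip: lin_chord)
      moreover have "lin r u \<noteq> Q r"
        using lin_inj[of r u "real r + 1"] that by (auto simp: lin_def)
      ultimately show ?thesis
        using loop_chord_boundary[OF cs, of r] that by (auto simp: N_def Q_def loop_chord_def)
    qed
    have n: "norm z \<le> 1" "norm w \<le> 1" using zw chord_subset_cball by fastforce+
    have "z = w"
    proof (cases "norm z < 1 \<or> norm w < 1")
      case True
      then show ?thesis using surface_proj_interior[OF g] n eq by metis
    next
      case False
      then have n1: "norm z = 1" "norm w = 1" using n by auto
      have st: "is_crossing g (cs ! s)" "is_crossing g (cs ! t)"
        using crossing_list_nth[OF cs] s t by (auto simp: N_def)
      have zw': "z = polygon_point g (crossing_out (cs ! s))" "w = polygon_point g (crossing_out (cs ! t))"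
        using start n1 s t by (auto simp: z_def w_def)
      then have "cs ! s = cs ! t"
        using crossing_unique[OF st] eq surface_proj_crossing st by simp
      then show ?thesis
        using zw' by simp
    qed
    then have "s = t" using loop_chords_disjoint[OF cs] zw s t by (auto simp: N_def)
    then show "x = y" using lin_inj[of s x y] \<open>z = w\<close> s by (simp add: z_def w_def)
  qed
  moreover have "q ` {0..real N} = crossing_loop g cs"
  proof (intro equalityI subsetI)
    fix v assume "v \<in> q ` {0..real N}"
    then obtain x where x: "0 \<le> x" "x \<le> real N" "v = surface_proj g (lin (ix x) x)"
      by (auto simp: q_def)
    then have "lin (ix x) x \<in> polygon_chord g (loop_chord g cs (ix x))"
      using ix[of x] by (auto simp flip: lin_chord)
    then show "v \<in> crossing_loop g cs"
      using x ix[of x] by (auto simp: crossing_loop_def N_def)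
  next
    fix v assume "v \<in> crossing_loop g cs"
    then obtain t z where t: "t < N" "z \<in> polygon_chord g (loop_chord g cs t)" "v = surface_proj g z"
      by (auto simp: crossing_loop_def N_def)
    then obtain x where x: "real t \<le> x" "x \<le> real t + 1" "v = surface_proj g (lin t x)"
      by (auto simp flip: lin_chord)
    show "v \<in> q ` {0..real N}"
    proof (cases "ix x = t")
      case True
      then show ?thesis using x t by (auto simp: q_def)
    next
      case False
      then have x1: "x = real t + 1" and t': "Suc t < N"
        using x t by (auto simp: ix_def min_def split: if_splits) linarith+
      then have "ix x = Suc t" by (auto simp: ix_def min_def)
      then have "v = q x"
        using x x1 t' glue[of t] by (simp add: q_def lin_def)
      then show ?thesis using x x1 t' by auto
    qed
  qed
  ultimately show ?thesis
    using simple_loop_from_interval[OF _ cont] N by simp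
qed

section \<open>Maps to the circle\<close>

lemma cos_polygon_period: "0 < g \<Longrightarrow> cos (2 * pi * (4 * real g - t) / (4 * real g)) = cos (2 * pi * t / (4 * real g))"
  using inner_polygon_point[of g "4 * real g - t" 0] inner_polygon_point[of g "-t" 0]
    polygon_point_periodic[of g "-t"]
  by simp

lemma cos_le_polygon:
  assumes "0 < g" "0 \<le> r" "r \<le> t" "t \<le> 4 * real g - r"
  shows "cos (2 * pi * t / (4 * real g)) \<le> cos (2 * pi * r / (4 * real g))"
proof -
  consider "t = r" | "t = 4 * real g - r" | "r < t" "t < 4 * real g - r"
    using assms by linarith
  then show ?thesis
  proof cases
    case 2
    then show ?thesis using cos_polygon_period[OF assms(1), of r] by simp
  next
    case 3
    then show ?thesis using cos_less_polygon[of g r t] assms by simp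
  qed simp
qed

text \<open>
  The height is constantly \<open>2 * pi\<close> on side \<open>4 * l + 1\<close>, vanishes away from the sides
  \<open>4 * l\<close>, \<open>4 * l + 1\<close>, \<open>4 * l + 2\<close>, and takes equal values at paired points of the sides
  \<open>4 * l\<close> and \<open>4 * l + 2\<close>. Hence \<open>exp (\<i> * height)\<close> descends to the surface, and its
  degree along a loop counts the passages through side \<open>4 * l + 1\<close>.
\<close>

definition height :: "nat \<Rightarrow> nat \<Rightarrow> complex \<Rightarrow> real" where
  "height g l z = 2 * pi * max 0 (min 1
     ((z \<bullet> polygon_point g (4 * real l + 3 / 2) - cos (2 * pi * (3 / 2) / (4 * real g))) /
      (cos (2 * pi * (1 / 2) / (4 * real g)) - cos (2 * pi * (3 / 2) / (4 * real g)))))"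

lemma continuous_on_height: "continuous_on S (height g l)"
proof -
  have "continuous_on S (\<lambda>z. (z \<bullet> a - b) * c)" for a :: complex and b c :: real
    by (intro continuous_intros)
  then show ?thesis
    unfolding height_def divide_inverse by (intro continuous_intros continuous_on_max continuous_on_min)
qed

lemma height_denominator:
  "0 < g \<Longrightarrow> cos (2 * pi * (3 / 2) / (4 * real g)) < cos (2 * pi * (1 / 2) / (4 * real g))"
  by (intro cos_less_polygon) auto

lemma height_near:
  assumes g: "0 < g" and t: "\<bar>t - (4 * real l + 3 / 2)\<bar> \<le> 1 / 2"
  shows "height g l (polygon_point g t) = 2 * pi"
proof -
  have "cos (2 * pi * (1 / 2) / (4 * real g)) \<le> polygon_point g t \<bullet> polygon_point g (4 * real l + 3 / 2)"
    unfolding inner_polygon_point cos_polygon_abs[symmetric, of "t - (4 * real l + 3 / 2)"]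
    using g t by (intro cos_le_polygon) auto
  then show ?thesis
    using height_denominator[OF g] by (simp add: height_def min_absorb1 max_absorb2)
qed

lemma height_far:
  assumes g: "0 < g" and t: "3 / 2 \<le> \<bar>t - (4 * real l + 3 / 2)\<bar>" "\<bar>t - (4 * real l + 3 / 2)\<bar> \<le> 4 * real g - 3 / 2"
  shows "height g l (polygon_point g t) = 0"
proof -
  have "polygon_point g t \<bullet> polygon_point g (4 * real l + 3 / 2) \<le> cos (2 * pi * (3 / 2) / (4 * real g))"
    unfolding inner_polygon_point cos_polygon_abs[symmetric, of "t - (4 * real l + 3 / 2)"]
    using g t by (intro cos_le_polygon) auto
  then have "(polygon_point g t \<bullet> polygon_point g (4 * real l + 3 / 2) - cos (2 * pi * (3 / 2) / (4 * real g))) /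
      (cos (2 * pi * (1 / 2) / (4 * real g)) - cos (2 * pi * (3 / 2) / (4 * real g))) \<le> 0"
    using height_denominator[OF g] by (intro divide_nonpos_pos) auto
  then show ?thesis by (simp add: height_def max_absorb1)
qed

lemma height_pairing:
  assumes l: "l < g" and j: "j < 4 * g" "j mod 4 \<in> {0, 1}" and s: "0 \<le> s" "s \<le> 1"
  shows "height g l (polygon_point g (real j + s)) - height g l (polygon_point g (real j + 3 - s)) =
    (if j = 4 * l + 1 then 2 * pi else 0)"
proof -
  have g: "0 < g" using l by simp
  define q where "q = j div 4"
  have q: "q < g" using j by (simp add: q_def)
  have jq: "j = 4 * q \<or> j = 4 * q + 1"
  proof -
    have "4 * q + j mod 4 = j" by (simp add: q_def)
    then show ?thesis using j(2) by auto
  qed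
  have lg: "real l + 1 \<le> real g" "real q + 1 \<le> real g" using l q by linarith+
  consider "q < l" | "l < q" | "j = 4 * l" | "j = 4 * l + 1" using jq by linarith
  then show ?thesis
  proof cases
    case 1
    then have ql: "real q + 1 \<le> real l" by linarith
    have "height g l (polygon_point g (real j + s)) = 0" "height g l (polygon_point g (real j + 3 - s)) = 0"
      using jq ql lg s by (auto intro!: height_far[OF g] simp: abs_if)
    then show ?thesis using 1 jq by auto
  next
    case 2
    then have ql: "real l + 1 \<le> real q" by linarith
    have "height g l (polygon_point g (real j + s)) = 0" "height g l (polygon_point g (real j + 3 - s)) = 0"
      using jq ql lg s by (auto intro!: height_far[OF g] simp: abs_if)
    then show ?thesis using 2 jq by auto
  next
    case 3
    have "polygon_point g (real j + s) \<bullet> polygon_point g (4 * real l + 3 / 2) =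
        polygon_point g (real j + 3 - s) \<bullet> polygon_point g (4 * real l + 3 / 2)"
    proof -
      have "real j + 3 - s - (4 * real l + 3 / 2) = - (real j + s - (4 * real l + 3 / 2))"
        using 3 by simp
      then show ?thesis unfolding inner_polygon_point by (metis abs_minus_cancel cos_polygon_abs)
    qed
    then show ?thesis using 3 by (simp add: height_def)
  next
    case 4
    have "height g l (polygon_point g (real j + s)) = 2 * pi" "height g l (polygon_point g (real j + 3 - s)) = 0"
      using 4 lg s by (auto intro!: height_near[OF g] height_far[OF g] simp: abs_if)
    then show ?thesis using 4 by auto
  qed
qed

lemma height_crossing:
  assumes "l < g" "is_crossing g c"
  shows "height g l (polygon_point g (crossing_in c)) - height g l (polygon_point g (crossing_out c)) =
    (if fst c = 4 * l + 1 then 2 * pi else 0)"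
  using assms height_pairing[of l g "fst c" "snd c"]
  by (simp add: is_crossing_def crossing_in_def crossing_out_def)

lemma surface_circle_map:
  assumes l: "l < g"
  obtains F where "continuous_map (genus_surface g) (top_of_set (sphere 0 1)) F"
    "\<And>z. norm z \<le> 1 \<Longrightarrow> F (surface_proj g z) = exp (\<i> * complex_of_real (height g l z))"
proof -
  define f where "f z = exp (\<i> * complex_of_real (height g l z))" for z
  have pair: "f x = f y" if "side_pairing g x y" for x y
  proof -
    obtain j s where "j < 4 * g" "j mod 4 \<in> {0, 1}" "0 \<le> s" "s \<le> 1"
      and xy: "x = polygon_point g (real j + s)" "y = polygon_point g (real j + 3 - s)"
      using \<open>side_pairing g x y\<close> by (auto simp: side_pairing_def)
    then have "height g l x = height g l y \<or> height g l x = height g l y + 2 * pi"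
      using height_pairing[OF l, of j s] by (auto split: if_splits)
    then show ?thesis
      by (auto simp: f_def cis_conv_exp[symmetric] cis_mult[symmetric])
  qed
  have cont: "continuous_map (top_of_set (cball 0 1)) (top_of_set (sphere 0 1)) f"
    by (auto simp: f_def continuous_map_in_subtopology intro!: continuous_intros continuous_on_height)
  obtain F where F: "continuous_map (genus_surface g) (top_of_set (sphere 0 1)) F"
    "\<And>z. z \<in> topspace (top_of_set (cball 0 1)) \<Longrightarrow> F (surface_proj g z) = f z"
  proof (rule quotient_map_lift_exists[OF quotient_map_surface_proj cont])
    fix x y assume xy: "x \<in> topspace (top_of_set (cball (0::complex) 1))"
      "y \<in> topspace (top_of_set (cball (0::complex) 1))" "surface_proj g x = surface_proj g y"
    then have "equivclp (side_pairing g) x y"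
      using surface_proj_eq_iff[of x y g] by (simp add: surface_rel_def)
    then show "f x = f y"
      by (induction rule: equivclp_induct) (auto dest: pair)
  qed metis
  then show ?thesis by (intro that[of F]) (auto simp: f_def)
qed

text \<open>On a simple loop this says that \<open>F\<close> has degree zero. Stated for the point
  set, it depends neither on a parametrisation nor on an orientation.\<close>

definition has_logarithm :: "'a topology \<Rightarrow> ('a \<Rightarrow> complex) \<Rightarrow> 'a set \<Rightarrow> bool" where
  "has_logarithm X F \<gamma> \<longleftrightarrow> (\<exists>G. continuous_map (subtopology X \<gamma>) euclideanreal G \<and>
     (\<forall>x\<in>\<gamma>. F x = exp (\<i> * complex_of_real (G x))))"

text \<open>A circle-valued map on the circle has a continuous logarithm iff it is null-homotopic,
  and null-homotopy is transported along the free homotopy composed with \<open>F\<close>. Inverting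
  the parametrisation, a homeomorphism onto \<open>\<gamma>\<close>, carries the logarithm from the
  circle back to the loop.\<close>

lemma homotopic_simple_loops_logarithm:
  assumes haus: "Hausdorff_space X" and F: "continuous_map X (top_of_set (sphere 0 1)) F"
    and hom: "homotopic_simple_loops X \<gamma> \<delta>" and log: "has_logarithm X F \<delta>"
  shows "has_logarithm X F \<gamma>"
proof -
  obtain p q where p: "simple_loop_param X p \<gamma>" and q: "simple_loop_param X q \<delta>"
    and pq: "homotopic_with (\<lambda>_. True) (top_of_set (sphere 0 1)) X p q"
    using hom by (auto simp: homotopic_simple_loops_def)
  obtain G where G: "continuous_map (subtopology X \<delta>) euclideanreal G"
      "\<And>x. x \<in> \<delta> \<Longrightarrow> F x = exp (\<i> * complex_of_real (G x))"
    using log by (auto simp: has_logarithm_def)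
  have "continuous_map (top_of_set (sphere 0 1)) (subtopology X \<delta>) q"
    using q by (auto simp: simple_loop_param_def continuous_map_in_subtopology)
  from continuous_map_compose[OF this G(1)] have "continuous_on (sphere 0 1) (G \<circ> q)"
    by simp
  moreover have "\<forall>x\<in>sphere 0 1. (F \<circ> q) x = exp (\<i> * of_real ((G \<circ> q) x))"
    using G(2) q by (auto simp: simple_loop_param_def)
  ultimately obtain a where "homotopic_with_canon (\<lambda>h. True) (sphere 0 1) (sphere 0 1) (F \<circ> q) (\<lambda>t. a)"
    using inessential_eq_continuous_logarithm_circle by blast
  moreover have "homotopic_with_canon (\<lambda>h. True) (sphere 0 1) (sphere 0 1) (F \<circ> p) (F \<circ> q)"
    using homotopic_with_compose_continuous_map_left[OF pq F] by simp
  ultimately have "homotopic_with_canon (\<lambda>h. True) (sphere 0 1) (sphere 0 1) (F \<circ> p) (\<lambda>t. a)"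
    using homotopic_with_trans by blast
  then obtain L where L: "continuous_on (sphere 0 1) L"
      "\<And>x. x \<in> sphere 0 1 \<Longrightarrow> F (p x) = exp (\<i> * complex_of_real (L x))"
    using inessential_eq_continuous_logarithm_circle[of "sphere 0 1" "F \<circ> p"] by auto
  have "\<gamma> \<subseteq> topspace X"
    using p by (auto simp: simple_loop_param_def continuous_map_def)
  then have "homeomorphic_map (top_of_set (sphere 0 1)) (subtopology X \<gamma>) p"
    using p haus by (intro continuous_imp_homeomorphic_map)
      (auto simp: simple_loop_param_def continuous_map_in_subtopology compact_space_subtopology
        Hausdorff_space_subtopology)
  then obtain r where "homeomorphic_maps (top_of_set (sphere 0 1)) (subtopology X \<gamma>) p r"
    by (auto simp: homeomorphic_map_maps)
  then have r: "continuous_map (subtopology X \<gamma>) (top_of_set (sphere 0 1)) r" "\<And>x. x \<in> \<gamma> \<Longrightarrow> p (r x) = x"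
    using \<open>\<gamma> \<subseteq> topspace X\<close> by (auto simp: homeomorphic_maps_def)
  have "continuous_map (subtopology X \<gamma>) euclideanreal (L \<circ> r)"
    using L(1) by (intro continuous_map_compose[OF r(1)]) simp
  moreover have "F x = exp (\<i> * complex_of_real ((L \<circ> r) x))" if "x \<in> \<gamma>" for x
  proof -
    have "r x \<in> sphere 0 1"
      using r(1) that \<open>\<gamma> \<subseteq> topspace X\<close> by (auto simp: continuous_map_def)
    then show ?thesis using L(2)[of "r x"] r(2)[OF that] by simp
  qed
  ultimately show ?thesis unfolding has_logarithm_def by blast
qed

text \<open>\<open>u - v\<close> takes values in the discrete set of multiples of
  \<open>2 * pi\<close>, so it is constant on a connected set.\<close>

lemma exp_i_eq_constant_diff:
  fixes u v :: "complex \<Rightarrow> real"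
  assumes S: "connected S" and u: "continuous_on S u" and v: "continuous_on S v"
    and eq: "\<And>z. z \<in> S \<Longrightarrow> exp (\<i> * complex_of_real (u z)) = exp (\<i> * complex_of_real (v z))"
    and ab: "a \<in> S" "b \<in> S"
  shows "u b - u a = v b - v a"
proof -
  have *: "\<exists>n::int. u z - v z = 2 * pi * of_int n" if z: "z \<in> S" for z
  proof -
    obtain n :: int where "\<i> * complex_of_real (u z) = \<i> * complex_of_real (v z) + (of_int (2 * n) * pi) * \<i>"
      using eq[OF z] by (auto simp: exp_eq)
    then have "\<i> * complex_of_real (u z) = \<i> * complex_of_real (v z + 2 * pi * of_int n)"
      by (simp add: algebra_simps)
    then have "u z = v z + 2 * pi * of_int n"
      by (simp only: mult_cancel_left of_real_eq_iff) simp
    then show ?thesis by auto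
  qed
  have "(\<lambda>z. u z - v z) constant_on S"
  proof (rule continuous_discrete_range_constant[OF S])
    show "continuous_on S (\<lambda>z. u z - v z)" by (intro continuous_intros u v)
    fix x assume x: "x \<in> S"
    have "2 * pi \<le> norm ((u y - v y) - (u x - v x))" if y: "y \<in> S" "u y - v y \<noteq> u x - v x" for y
    proof -
      obtain m n :: int where mn: "u x - v x = 2 * pi * of_int m" "u y - v y = 2 * pi * of_int n"
        using *[OF x] *[OF y(1)] by blast
      then have "1 \<le> \<bar>n - m\<bar>" using y by auto
      then have "1 \<le> \<bar>real_of_int n - real_of_int m\<bar>" by linarith
      then have "2 * pi * 1 \<le> 2 * pi * \<bar>real_of_int n - real_of_int m\<bar>" by (intro mult_left_mono) auto
      also have "\<dots> = norm ((u y - v y) - (u x - v x))"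
        unfolding mn by (simp add: abs_mult flip: right_diff_distrib)
      finally show ?thesis by simp
    qed
    then show "\<exists>e>0. \<forall>y. y \<in> S \<and> u y - v y \<noteq> u x - v x \<longrightarrow> e \<le> norm ((u y - v y) - (u x - v x))"
      by (intro exI[of _ "2 * pi"]) auto
  qed
  then obtain c where "\<And>z. z \<in> S \<Longrightarrow> u z - v z = c" by (auto simp: constant_on_def)
  from this[OF ab(1)] this[OF ab(2)] show ?thesis by simp
qed

lemma sum_cyclic_shift: "(\<Sum>t<N. f (Suc t mod N)) = (\<Sum>t<N. f t :: 'a :: comm_monoid_add)"
proof (cases N)
  case (Suc M)
  have "(\<Sum>t<N. f (Suc t mod N)) = (\<Sum>t<M. f (Suc t)) + f 0"
    by (simp add: Suc)
  then show ?thesis by (simp add: Suc sum.lessThan_Suc_shift add.commute del: sum.lessThan_Suc)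
qed simp

text \<open>Along each chord a logarithm \<open>G\<close> would change exactly as the height does.
  Its changes around the loop sum to zero, while those of the height sum to \<open>2 * pi\<close>
  times the number of crossings of side \<open>4 * l + 1\<close>: all of them count with the same
  sign.\<close>

lemma crossing_loop_no_logarithm:
  assumes cs: "crossing_list g cs" and l: "l < g" and c: "c \<in> set cs" "fst c = 4 * l + 1"
    and F: "\<And>z. norm z \<le> 1 \<Longrightarrow> F (surface_proj g z) = exp (\<i> * complex_of_real (height g l z))"
  shows "\<not> has_logarithm (genus_surface g) F (crossing_loop g cs)"
proof
  assume "has_logarithm (genus_surface g) F (crossing_loop g cs)"
  then obtain G where G: "continuous_map (subtopology (genus_surface g) (crossing_loop g cs)) euclideanreal G"
      "\<And>x. x \<in> crossing_loop g cs \<Longrightarrow> F x = exp (\<i> * complex_of_real (G x))"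
    by (auto simp: has_logarithm_def)
  define N where "N = length cs"
  define A where "A t = polygon_point g (crossing_in (cs ! t))" for t
  define B where "B t = polygon_point g (crossing_out (cs ! t))" for t
  have step: "G (surface_proj g (A (Suc t mod N))) - G (surface_proj g (A t)) =
      height g l (A (Suc t mod N)) - height g l (B t)" if t: "t < N" for t
  proof -
    define S where "S = polygon_chord g (loop_chord g cs t)"
    have S1: "S \<subseteq> cball 0 1" unfolding S_def by (rule chord_subset_cball)
    have S2: "surface_proj g ` S \<subseteq> crossing_loop g cs" using t by (auto simp: S_def crossing_loop_def N_def)
    have "continuous_map (top_of_set S) (genus_surface g) (surface_proj g)"
    proof -
      have "continuous_map (subtopology (top_of_set (cball 0 1)) S) (genus_surface g) (surface_proj g)"
        by (rule continuous_map_from_subtopology[OF continuous_map_surface_proj])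
      then show ?thesis using S1 by (simp add: subtopology_subtopology Int_absorb1)
    qed
    then have "continuous_map (top_of_set S) (subtopology (genus_surface g) (crossing_loop g cs)) (surface_proj g)"
      using S2 by (auto simp: continuous_map_in_subtopology)
    from continuous_map_compose[OF this G(1)] have "continuous_on S (G \<circ> surface_proj g)"
      by simp
    moreover have "exp (\<i> * complex_of_real ((G \<circ> surface_proj g) z)) = exp (\<i> * complex_of_real (height g l z))"
      if "z \<in> S" for z
      using that S1 S2 F[of z] G(2)[of "surface_proj g z"] by (auto simp: subset_iff)
    moreover have "connected S" by (simp add: S_def polygon_chord_def)
    moreover have "B t \<in> S" "A (Suc t mod N) \<in> S"
      using loop_chord_snd[OF cs, of t] t
      by (auto simp: S_def A_def B_def polygon_chord_def N_def loop_chord_def)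
    ultimately have "(G \<circ> surface_proj g) (A (Suc t mod N)) - (G \<circ> surface_proj g) (B t) =
        height g l (A (Suc t mod N)) - height g l (B t)"
      using exp_i_eq_constant_diff[of S "G \<circ> surface_proj g" "height g l"] continuous_on_height by blast
    moreover have "surface_proj g (B t) = surface_proj g (A t)"
      using surface_proj_crossing[OF crossing_list_nth[OF cs]] t by (simp add: A_def B_def N_def)
    ultimately show ?thesis by simp
  qed
  have "0 = (\<Sum>t<N. G (surface_proj g (A (Suc t mod N))) - G (surface_proj g (A t)))"
    using sum_cyclic_shift[of "\<lambda>t. G (surface_proj g (A t))" N] by (simp add: sum_subtractf)
  also have "\<dots> = (\<Sum>t<N. height g l (A (Suc t mod N)) - height g l (B t))"
    using step by simp
  \<comment> \<open>Regrouping: instead of the two ends of a chord, the two boundary points of one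
    crossing are now compared.\<close>
  also have "\<dots> = (\<Sum>t<N. height g l (A t) - height g l (B t))"
    using sum_cyclic_shift[of "\<lambda>t. height g l (A t)" N] by (simp add: sum_subtractf)
  also have "\<dots> = (\<Sum>t<N. if fst (cs ! t) = 4 * l + 1 then 2 * pi else 0)"
    using height_crossing[OF l crossing_list_nth[OF cs]] by (intro sum.cong) (auto simp: A_def B_def N_def)
  also have "\<dots> > 0"
  proof -
    obtain t where "t < N" "cs ! t = c" using c by (auto simp: in_set_conv_nth N_def)
    then show ?thesis
      using c by (intro sum_pos2[of _ t]) auto
  qed
  finally show False by simp
qed

lemma compactin_crossing_loop: "compactin (genus_surface g) (crossing_loop g cs)"
  unfolding crossing_loop_def
proof (intro compactin_Union finite_imageI ballI)
  fix S assume "S \<in> (\<lambda>t. surface_proj g ` polygon_chord g (loop_chord g cs t)) ` {..<length cs}"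
  then obtain t where S: "S = surface_proj g ` polygon_chord g (loop_chord g cs t)" by auto
  have "compactin (top_of_set (cball 0 1)) (polygon_chord g (loop_chord g cs t))"
    using chord_subset_cball by (auto simp: compactin_subtopology polygon_chord_def)
  then show "compactin (genus_surface g) S"
    unfolding S by (rule image_compactin[OF _ continuous_map_surface_proj])
qed simp

text \<open>Without a crossing of side \<open>4 * l + 1\<close> the height agrees on all preimages
  of each point of the loop, so it descends to the loop and is itself the logarithm.\<close>

lemma crossing_loop_logarithm:
  assumes cs: "crossing_list g cs" and l: "l < g" and avoid: "\<And>c. c \<in> set cs \<Longrightarrow> fst c \<noteq> 4 * l + 1"
    and F: "\<And>z. norm z \<le> 1 \<Longrightarrow> F (surface_proj g z) = exp (\<i> * complex_of_real (height g l z))"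
  shows "has_logarithm (genus_surface g) F (crossing_loop g cs)"
proof -
  have g: "0 < g" using l by simp
  define V where "V = crossing_loop g cs"
  define U where "U = {z \<in> topspace (top_of_set (cball 0 1)). surface_proj g z \<in> V}"
  \<comment> \<open>A quotient map restricts to a quotient map over a closed set; this is what makes
    the descended function continuous.\<close>
  have clo: "closedin (genus_surface g) V"
    unfolding V_def by (rule compactin_imp_closedin[OF Hausdorff_genus_surface[OF g] compactin_crossing_loop])
  have quo: "quotient_map (subtopology (top_of_set (cball 0 1)) U) (subtopology (genus_surface g) V) (surface_proj g)"
    by (rule quotient_map_restriction[OF quotient_map_surface_proj]) (use clo U_def in auto)
  have "continuous_map (subtopology (top_of_set (cball 0 1)) U) euclideanreal (height g l)"
    by (auto simp: subtopology_subtopology continuous_on_height)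
  then obtain G where G: "continuous_map (subtopology (genus_surface g) V) euclideanreal G"
      "\<And>z. z \<in> topspace (subtopology (top_of_set (cball 0 1)) U) \<Longrightarrow> G (surface_proj g z) = height g l z"
  proof (rule quotient_map_lift_exists[OF quo])
    fix z w assume "z \<in> topspace (subtopology (top_of_set (cball 0 1)) U)"
      "w \<in> topspace (subtopology (top_of_set (cball 0 1)) U)" and eq: "surface_proj g z = surface_proj g w"
    then have z: "norm z \<le> 1" and w: "norm w \<le> 1" and "surface_proj g z \<in> crossing_loop g cs"
      by (auto simp: U_def V_def)
    then obtain t v where v: "t < length cs" "v \<in> polygon_chord g (loop_chord g cs t)" "surface_proj g z = surface_proj g v"
      by (auto simp: crossing_loop_def)
    from cs v(1,2) show "height g l z = height g l w"
    proof (cases rule: chord_point_cases)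
      case interior
      then have "v = z" "v = w" using surface_proj_interior[OF g, of v] v(3) eq z w by auto
      then show ?thesis by simp
    next
      case (boundary c)
      then have c: "is_crossing g c" using cs by (simp add: crossing_list_def)
      have *: "height g l u = height g l (polygon_point g (crossing_in c))"
        if "norm u \<le> 1" "surface_proj g u = surface_proj g (polygon_point g (crossing_in c))" for u
        using surface_proj_eq_crossing[OF c that] height_crossing[OF l c] avoid[OF boundary(1)] by auto
      show ?thesis using *[OF z] *[OF w] boundary(2) v(3) eq by metis
    qed
  qed (rule that)
  have "F x = exp (\<i> * complex_of_real (G x))" if "x \<in> V" for x
  proof -
    have "x \<in> topspace (genus_surface g)" using that clo closedin_subset by blast
    then obtain z where z: "norm z \<le> 1" "x = surface_proj g z"
      by (auto simp: topspace_genus_surface_proj)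
    then show ?thesis using F[of z] G(2)[of z] that by (auto simp: U_def)
  qed
  then show ?thesis using G(1) unfolding has_logarithm_def V_def by blast
qed

section \<open>The side loop\<close>

definition side_loop :: "nat \<Rightarrow> nat \<Rightarrow> complex set set" where
  "side_loop g l = (\<lambda>s. surface_proj g (polygon_point g (real (4 * l + 1) + s))) ` {0..1}"

lemma side_crossing: "l < g \<Longrightarrow> 0 < s \<Longrightarrow> s < 1 \<Longrightarrow> is_crossing g (4 * l + 1, s)"
  by (auto simp: is_crossing_def)

lemma simple_loop_side_loop:
  assumes l: "l < g"
  shows "simple_loop (genus_surface g) (side_loop g l)"
  unfolding side_loop_def
proof (rule simple_loop_from_interval)
  have g: "0 < g" using l by simp
  let ?q = "\<lambda>s. surface_proj g (polygon_point g (real (4 * l + 1) + s))"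
  show "continuous_map (top_of_set {0..1}) (genus_surface g) ?q"
  proof (rule continuous_map_compose[where g = "surface_proj g", unfolded o_def, OF _ continuous_map_surface_proj])
    show "continuous_map (top_of_set {0..1}) (top_of_set (cball 0 1)) (\<lambda>s. polygon_point g (real (4 * l + 1) + s))"
      by (auto simp: continuous_map_in_subtopology intro!: continuous_polygon_point continuous_intros)
  qed
  \<comment> \<open>The ends of the side are identified through its neighbour: they are the pair of
    side \<open>4 * l\<close> at parameter \<open>1\<close>.\<close>
  have "side_pairing g (polygon_point g (real (4 * l) + 1)) (polygon_point g (real (4 * l) + 3 - 1))"
    unfolding side_pairing_def using l by (intro exI[of _ "4 * l"] exI[of _ 1]) auto
  from surface_proj_pairing[OF this] show "?q 0 = ?q 1" by (simp add: add.commute)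
  have *: "s = t" if "s \<in> {0..<1}" "t \<in> {0..<1}" "?q s = ?q t" "0 < s" for s t
  proof -
    have "polygon_point g (real (4 * l + 1) + t) = polygon_point g (real (4 * l + 1) + s) \<or>
        polygon_point g (real (4 * l + 1) + t) = polygon_point g (real (4 * l + 1) + 3 - s)"
      using surface_proj_eq_crossing[OF side_crossing[OF l, of s], of "polygon_point g (real (4 * l + 1) + t)"] that
      by (simp add: crossing_in_def crossing_out_def)
    moreover have "\<bar>t - s\<bar> < 4 * real g" "\<bar>t - (3 - s)\<bar> < 4 * real g"
      using that g by auto
    ultimately have "t = s \<or> t = 3 - s"
      using polygon_point_inj[OF g, of "real (4 * l + 1) + t" "real (4 * l + 1) + s"]
        polygon_point_inj[OF g, of "real (4 * l + 1) + t" "real (4 * l + 1) + 3 - s"] by fastforce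
    then show ?thesis using that by auto
  qed
  show "inj_on ?q {0..<1}"
  proof (rule inj_onI)
    fix s t :: real assume st: "s \<in> {0..<1}" "t \<in> {0..<1}" "?q s = ?q t"
    consider "s = 0" "t = 0" | "0 < s" | "0 < t" using st by fastforce
    then show "s = t"
      using *[OF st] *[OF st(2,1) st(3)[symmetric]] by cases auto
  qed
qed simp

text \<open>The height is constantly \<open>2 * pi\<close> on the side, so \<open>F\<close> is
  \<open>1\<close> there and zero is a logarithm. Loops that cross this side have none, which is how
  they are told apart from it.\<close>

lemma side_loop_logarithm:
  assumes l: "l < g"
    and F: "\<And>z. norm z \<le> 1 \<Longrightarrow> F (surface_proj g z) = exp (\<i> * complex_of_real (height g l z))"
  shows "has_logarithm (genus_surface g) F (side_loop g l)"
proof -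
  have "F x = 1" if x: "x \<in> side_loop g l" for x
  proof -
    obtain s where s: "0 \<le> s" "s \<le> 1" "x = surface_proj g (polygon_point g (real (4 * l + 1) + s))"
      using x by (auto simp: side_loop_def)
    have "height g l (polygon_point g (real (4 * l + 1) + s)) = 2 * pi"
      using l s by (intro height_near) (auto simp: abs_if)
    then show ?thesis
      using F[of "polygon_point g (real (4 * l + 1) + s)"] s unfolding cis_conv_exp[symmetric] by simp
  qed
  then show ?thesis
    unfolding has_logarithm_def by (intro exI[of _ "\<lambda>_. 0"]) auto
qed

text \<open>Interior points of the disc never project into the image of a side, so meeting the side
  means crossing it. The ends of the side drop out because crossings are not vertices.\<close>

lemma crossing_loop_Int_side_loop:
  assumes cs: "crossing_list g cs" and l: "l < g"
  shows "crossing_loop g cs \<inter> side_loop g l =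
    (\<lambda>c. surface_proj g (polygon_point g (crossing_in c))) ` {c \<in> set cs. fst c = 4 * l + 1}"
proof (intro equalityI subsetI)
  have g: "0 < g" using l by simp
  fix x assume "x \<in> crossing_loop g cs \<inter> side_loop g l"
  then obtain t z s where t: "t < length cs" "z \<in> polygon_chord g (loop_chord g cs t)" "x = surface_proj g z"
    and s: "0 \<le> s" "s \<le> 1" "x = surface_proj g (polygon_point g (real (4 * l + 1) + s))"
    by (auto simp: crossing_loop_def side_loop_def)
  from cs t(1,2) show "x \<in> (\<lambda>c. surface_proj g (polygon_point g (crossing_in c))) ` {c \<in> set cs. fst c = 4 * l + 1}"
  proof (cases rule: chord_point_cases)
    case interior
    then show ?thesis
      using surface_proj_interior[OF g, of z "polygon_point g (real (4 * l + 1) + s)"] t s by auto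
  next
    case (boundary c)
    then have c: "is_crossing g c" using cs by (simp add: crossing_list_def)
    have eq: "surface_proj g (polygon_point g (real (4 * l + 1) + s)) = surface_proj g (polygon_point g (crossing_in c))"
      using boundary t s by simp
    have "\<not> polygon_vertex g (polygon_point g (real (4 * l + 1) + s))"
      using surface_proj_eq_crossing[OF c _ eq] crossing_not_vertex[OF c] by auto
    then have "real (4 * l + 1) + s \<notin> \<int>" using polygon_vertexI by blast
    then have "s \<noteq> 0" "s \<noteq> 1" by auto
    then have "is_crossing g (4 * l + 1, s)" using s by (intro side_crossing[OF l]) auto
    then have "c = (4 * l + 1, s)"
      using crossing_unique[OF c, of "(4 * l + 1, s)"] eq by (simp add: crossing_in_def)
    then show ?thesis using boundary t by (intro image_eqI[of _ _ c]) auto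
  qed
next
  fix x assume "x \<in> (\<lambda>c. surface_proj g (polygon_point g (crossing_in c))) ` {c \<in> set cs. fst c = 4 * l + 1}"
  then obtain c where c: "c \<in> set cs" "fst c = 4 * l + 1" "x = surface_proj g (polygon_point g (crossing_in c))"
    by auto
  then have cr: "is_crossing g c" using cs by (simp add: crossing_list_def)
  obtain t where t: "t < length cs" "c = cs ! t" using c(1) by (auto simp: in_set_conv_nth)
  have "polygon_point g (crossing_out c) \<in> polygon_chord g (loop_chord g cs t)"
    by (simp add: polygon_chord_def loop_chord_def t)
  moreover have "x = surface_proj g (polygon_point g (crossing_out c))"
    using c surface_proj_crossing[OF cr] by simp
  ultimately have "x \<in> crossing_loop g cs" using t by (auto simp: crossing_loop_def)
  moreover have "x \<in> side_loop g l"
    unfolding side_loop_def using c cr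
    by (intro image_eqI[of _ _ "snd c"]) (auto simp: crossing_in_def is_crossing_def)
  ultimately show "x \<in> crossing_loop g cs \<inter> side_loop g l" by simp
qed

section \<open>Adding one loop to a system\<close>

lemma homotopic_simple_loops_sym: "homotopic_simple_loops X \<gamma> \<delta> \<Longrightarrow> homotopic_simple_loops X \<delta> \<gamma>"
  unfolding homotopic_simple_loops_def using homotopic_with_symD by blast

lemma homotopic_simple_loops_refl: "simple_loop X \<gamma> \<Longrightarrow> homotopic_simple_loops X \<gamma> \<gamma>"
  unfolding simple_loop_def homotopic_simple_loops_def
  by (metis homotopic_with_refl simple_loop_param_def)

lemma k_system_insert:
  assumes "k_system X m \<Gamma>" "simple_loop X \<gamma>"
    and "\<And>\<delta>. \<delta> \<in> \<Gamma> \<Longrightarrow> \<not> homotopic_simple_loops X \<delta> \<gamma> \<and> finite (\<delta> \<inter> \<gamma>) \<and> card (\<delta> \<inter> \<gamma>) \<le> m"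
  shows "k_system X m (insert \<gamma> \<Gamma>)"
  unfolding k_system_def
proof (intro conjI ballI impI)
  show "simple_loop X \<alpha>" if "\<alpha> \<in> insert \<gamma> \<Gamma>" for \<alpha>
    using that assms(1,2) unfolding k_system_def by blast
  fix \<alpha> \<beta> assume "\<alpha> \<in> insert \<gamma> \<Gamma>" "\<beta> \<in> insert \<gamma> \<Gamma>" "\<alpha> \<noteq> \<beta>"
  then consider "\<alpha> \<in> \<Gamma>" "\<beta> \<in> \<Gamma>" | "\<alpha> = \<gamma>" "\<beta> \<in> \<Gamma>" | "\<alpha> \<in> \<Gamma>" "\<beta> = \<gamma>" by blast
  then have "\<not> homotopic_simple_loops X \<alpha> \<beta> \<and> finite (\<alpha> \<inter> \<beta>) \<and> card (\<alpha> \<inter> \<beta>) \<le> m"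
  proof cases
    case 1
    then show ?thesis using assms(1) \<open>\<alpha> \<noteq> \<beta>\<close> unfolding k_system_def by blast
  next
    case 2
    then show ?thesis using assms(3)[of \<beta>] homotopic_simple_loops_sym[of X \<alpha> \<beta>] Int_commute[of \<alpha> \<beta>] by auto
  next
    case 3
    then show ?thesis using assms(3)[of \<alpha>] by simp
  qed
  then show "\<not> homotopic_simple_loops X \<alpha> \<beta>" "finite (\<alpha> \<inter> \<beta>)" "card (\<alpha> \<inter> \<beta>) \<le> m" by auto
qed

section \<open>The family of loops\<close>

text \<open>The chords of a loop in recursive form, with the final end as a parameter. A
  concatenation then splits blockwise, each piece being closed by the first arrival of the
  next.\<close>

fun gaps :: "(nat \<times> real) list \<Rightarrow> real \<Rightarrow> (real \<times> real) list" where
  "gaps [] e = []"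
| "gaps [c] e = [(crossing_out c, e)]"
| "gaps (c # c' # cs) e = (crossing_out c, crossing_in c') # gaps (c' # cs) e"

lemma length_gaps [simp]: "length (gaps cs e) = length cs"
  by (induction cs e rule: gaps.induct) auto

lemma gaps_nth:
  "t < length cs \<Longrightarrow> gaps cs e ! t =
    (crossing_out (cs ! t), if Suc t < length cs then crossing_in (cs ! Suc t) else e)"
proof (induction cs e arbitrary: t rule: gaps.induct)
  case (3 c c' cs e)
  then show ?case by (cases t) auto
qed auto

lemma gaps_append:
  "cs \<noteq> [] \<Longrightarrow> ds \<noteq> [] \<Longrightarrow> gaps (cs @ ds) e = gaps cs (crossing_in (hd ds)) @ gaps ds e"
proof (induction cs e rule: gaps.induct)
  case (2 c e)
  then show ?case by (cases ds) auto
qed auto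

lemma loop_chord_in_gaps:
  "t < length cs \<Longrightarrow> loop_chord g cs t \<in> set (gaps cs (4 * real g + crossing_in (cs ! 0)))"
  using gaps_nth[of t cs "4 * real g + crossing_in (cs ! 0)"] nth_mem[of t "gaps cs (4 * real g + crossing_in (cs ! 0))"]
  by (simp add: loop_chord_def)

lemma set_gaps_concat:
  assumes "\<And>i. blk i \<noteq> []"
  shows "set (gaps (concat (map blk [0..<Suc j])) e) =
    (\<Union>i<j. set (gaps (blk i) (crossing_in (hd (blk (Suc i)))))) \<union> set (gaps (blk j) e)"
proof (induction j arbitrary: e)
  case (Suc j)
  have "concat (map blk [0..<Suc (Suc j)]) = concat (map blk [0..<Suc j]) @ blk (Suc j)" by simp
  moreover have "concat (map blk [0..<Suc j]) \<noteq> []" using assms by simp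
  ultimately show ?case
    using gaps_append[of "concat (map blk [0..<Suc j])" "blk (Suc j)" e] assms Suc.IH
    by (auto simp: lessThan_Suc simp del: upt_Suc)
qed simp

lemma set_gaps_map:
  "set (gaps (map c [0..<Suc d]) e) =
    (\<lambda>l. (crossing_out (c l), crossing_in (c (Suc l)))) ` {..<d} \<union> {(crossing_out (c d), e)}"
  using set_gaps_concat[of "\<lambda>i. [c i]" d e] by auto

lemma sorted_wrt_concat_map:
  assumes "\<And>j. j < m \<Longrightarrow> sorted_wrt R (f j)"
    and "\<And>i j x y. i < j \<Longrightarrow> j < m \<Longrightarrow> x \<in> set (f i) \<Longrightarrow> y \<in> set (f j) \<Longrightarrow> R x y"
  shows "sorted_wrt R (concat (map f [0..<m]))"
  using assms
proof (induction m)
  case (Suc m)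
  then show ?case by (fastforce simp: sorted_wrt_append)
qed simp

text \<open>All parameters lie in the window from \<open>2\<close> to \<open>4 * g + 2\<close>, one
  period long, so the wrap-around conditions hold automatically and only linear order remains. The
  window fits the family below: departures lie above \<open>2\<close>, and the final return to block
  \<open>0\<close> lies below \<open>4 * g + 2\<close>.\<close>

lemma chords_disjoint:
  assumes "0 < g" "fst c < snd c" "fst d < snd d" "2 < fst c" "2 < fst d"
    "snd c < 4 * real g + 2" "snd d < 4 * real g + 2"
    and "snd c < fst d \<or> snd d < fst c \<or> (fst c < fst d \<and> snd d < snd c) \<or> (fst d < fst c \<and> snd c < snd d)"
  shows "polygon_chord g c \<inter> polygon_chord g d = {}"
  using assms(8)
proof (elim disjE conjE)
  assume "snd c < fst d"
  then show ?thesis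
    using chords_disjoint_separate[of g "fst c" "snd c" "fst d" "snd d"] assms by auto
next
  assume "snd d < fst c"
  then show ?thesis
    using chords_disjoint_separate[of g "fst d" "snd d" "fst c" "snd c"] assms by auto
next
  assume "fst c < fst d" "snd d < snd c"
  then show ?thesis
    using chords_disjoint_nested[of g "fst c" "fst d" "snd c" "snd d"] assms by auto
next
  assume "fst d < fst c" "snd c < snd d"
  then show ?thesis
    using chords_disjoint_nested[of g "fst d" "fst c" "snd d" "snd c"] assms by auto
qed

lemma frac_unit:
  fixes e :: real
  assumes "a < (n::nat)" "0 < e" "e < 1"
  shows "0 < (real a + e) / real n" "(real a + e) / real n < 1"
proof -
  have "real a + 1 \<le> real n" using assms by linarith
  then show "0 < (real a + e) / real n" "(real a + e) / real n < 1"
    using assms by (simp_all add: divide_simps)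
qed

lemma frac_less:
  fixes e f :: real
  assumes "a < (b::nat)" "0 < (n::nat)" "e < 1" "0 < f"
  shows "(real a + e) / real n < (real b + f) / real n"
proof -
  have "real a + 1 \<le> real b" using assms by linarith
  then show ?thesis using assms by (intro divide_strict_right_mono) auto
qed

text \<open>
  The \<open>(k + 1) * (n + 1)\<close> handles in use are split into \<open>k + 1\<close> blocks. In block \<open>j\<close> the loop
  of \<open>u\<close> runs through the handles \<open>0, \<dots>, depth u j - 1\<close> and then proceeds to the next block,
  cyclically. Only the chords linking two blocks can cross the corresponding chords of another
  loop. In an ordinary block the loops leave in the same transverse order in which they entered,
  so that a crossing occurs in the next link precisely if the order changes, and the number of
  changes around the cycle is even. For odd \<open>k\<close> the last block is twisted (one additional
  crossing of type \<open>a\<close>), which makes the number of crossings odd; either way it is not \<open>k + 1\<close>.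
\<close>

locale loop_family =
  fixes g k n :: nat and tie :: "(nat \<Rightarrow> nat) \<Rightarrow> real"
  assumes n: "0 < n" and room: "(k + 1) * (n + 1) \<le> g"
    and tie_inj: "inj_on tie ({..k} \<rightarrow>\<^sub>E {..<n})"
    and tie_unit: "\<And>u. u \<in> {..k} \<rightarrow>\<^sub>E {..<n} \<Longrightarrow> 0 < tie u \<and> tie u < 1"
begin

abbreviation indices :: "(nat \<Rightarrow> nat) set" where
  "indices \<equiv> {..k} \<rightarrow>\<^sub>E {..<n}"

definition twisted :: "nat \<Rightarrow> bool" where
  "twisted j \<longleftrightarrow> j = k \<and> odd k"

text \<open>Ties in the twisted block are broken by the order in block \<open>0\<close>.\<close>

definition offset :: "(nat \<Rightarrow> nat) \<Rightarrow> nat \<Rightarrow> real" where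
  "offset u j = (if twisted j then (real (u 0) + tie u) / real n else tie u)"

text \<open>A lexicographic order, by \<open>u j\<close> first and then by the offset. It keeps
  loops of equal depth apart on the sides they share.\<close>

definition position :: "(nat \<Rightarrow> nat) \<Rightarrow> nat \<Rightarrow> real" where
  "position u j = (real (u j) + offset u j) / real n"

text \<open>The direction is chosen so that chords nest. In an ordinary block the loop that stops
  earlier has the larger position and leaves outside the chords of those that go on; in the twisted
  block it has the smaller position and turns inside them.\<close>

definition depth :: "(nat \<Rightarrow> nat) \<Rightarrow> nat \<Rightarrow> nat" where
  "depth u j = (if twisted j then Suc (u j) else n - u j)"

text \<open>Blocks have \<open>n + 1\<close> handles although depths are at most \<open>n\<close>:
  the additional crossing of the twisted block lies in handle
  \<open>base j + depth u j\<close>.\<close>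

definition base :: "nat \<Rightarrow> nat" where
  "base j = j * (n + 1)"

definition block :: "(nat \<Rightarrow> nat) \<Rightarrow> nat \<Rightarrow> (nat \<times> real) list" where
  "block u j = map (\<lambda>l. (4 * (base j + l) + 1, position u j)) [0..<depth u j] @
     (if twisted j then [(4 * (base j + depth u j), position u j)] else [])"

definition crossings :: "(nat \<Rightarrow> nat) \<Rightarrow> (nat \<times> real) list" where
  "crossings u = concat (map (block u) [0..<Suc k])"

section \<open>Positions, blocks and lists of crossings\<close>

lemma g_pos: "0 < g"
  using room by (cases g) auto

lemma index_less: "u \<in> indices \<Longrightarrow> j \<le> k \<Longrightarrow> u j < n"
  by (auto simp: PiE_def Pi_def)

lemma offset_unit:
  assumes "u \<in> indices"
  shows "0 < offset u j" "offset u j < 1"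
  using frac_unit[OF index_less[OF assms, of 0]] tie_unit[OF assms] by (simp_all add: offset_def)

lemma position_unit:
  assumes u: "u \<in> indices" and j: "j \<le> k"
  shows "0 < position u j" "position u j < 1"
  unfolding position_def by (intro frac_unit index_less offset_unit u j)+

lemma position_less:
  assumes u: "u \<in> indices" and v: "v \<in> indices" and "u j < v j"
  shows "position u j < position v j"
  unfolding position_def by (intro frac_less assms n offset_unit)

lemma position_less_imp: "u \<in> indices \<Longrightarrow> v \<in> indices \<Longrightarrow> position u j < position v j \<Longrightarrow> u j \<le> v j"
  using position_less[of v u j] by force

lemma position_neq:
  assumes u: "u \<in> indices" and v: "v \<in> indices" and "u \<noteq> v"
  shows "position u j \<noteq> position v j"
proof
  assume eq: "position u j = position v j"
  have t: "tie u \<noteq> tie v" using tie_inj assms by (auto dest: inj_onD)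
  have uv: "u j = v j" using position_less[OF u v, of j] position_less[OF v u, of j] eq by force
  then have "twisted j" and z: "(real (u 0) + tie u) / real n = (real (v 0) + tie v) / real n"
    using eq t n by (auto simp: position_def offset_def split: if_splits)
  have "u 0 = v 0"
    using frac_less[of "u 0" "v 0" n "tie u" "tie v"] frac_less[of "v 0" "u 0" n "tie v" "tie u"]
      z n tie_unit[OF u] tie_unit[OF v] by force
  then show False using z t n by simp
qed

lemma depth_bounds:
  assumes "u \<in> indices" "j \<le> k"
  shows "0 < depth u j" "depth u j \<le> n"
  using index_less[OF assms] by (simp_all add: depth_def)

lemma base_mono: "i < j \<Longrightarrow> base i + n + 1 \<le> base j"
proof -
  assume "i < j"
  then have "Suc i * (n + 1) \<le> j * (n + 1)" by (intro mult_le_mono1) simp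
  then show ?thesis by (simp add: base_def)
qed

lemma base_bound: "j \<le> k \<Longrightarrow> base j + n < g"
  using base_mono[of j "Suc k"] room by (simp add: base_def)

lemma base_last: "base (Suc k) \<le> g"
  using room by (simp add: base_def)

lemma base_unique: "base i + l = base j + l' \<Longrightarrow> l \<le> n \<Longrightarrow> l' \<le> n \<Longrightarrow> i = j \<and> l = l'"
  using base_mono[of i j] base_mono[of j i] by (cases i j rule: linorder_cases) simp_all

lemma set_block:
  "c \<in> set (block u j) \<longleftrightarrow> (\<exists>l<depth u j. c = (4 * (base j + l) + 1, position u j)) \<or>
    (twisted j \<and> c = (4 * (base j + depth u j), position u j))"
  by (auto simp: block_def)

lemma set_crossings: "set (crossings u) = (\<Union>j\<le>k. set (block u j))"
  by (simp add: crossings_def atLeast0LessThan lessThan_Suc_atMost del: upt_Suc)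

lemma block_cases:
  assumes "u \<in> indices" "j \<le> k" "c \<in> set (block u j)"
  obtains l where "l \<le> n" "snd c = position u j" "fst c = 4 * (base j + l) + 1"
    | l where "0 < l" "l \<le> n" "snd c = position u j" "fst c = 4 * (base j + l)"
proof -
  have "(\<exists>l<depth u j. c = (4 * (base j + l) + 1, position u j)) \<or>
      c = (4 * (base j + depth u j), position u j)"
    using assms(3) unfolding set_block by blast
  then show ?thesis
    using that(1) that(2)[of "depth u j"] depth_bounds[OF assms(1,2)]
    by (elim disjE exE conjE) auto
qed

lemma block_crossing:
  assumes u: "u \<in> indices" and j: "j \<le> k" and c: "c \<in> set (block u j)"
  shows "is_crossing g c" "real (4 * base j) + 1 < crossing_in c" "crossing_out c < real (4 * base j + 4 * n + 4)"
proof -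
  have "is_crossing g c \<and> real (4 * base j) + 1 < crossing_in c \<and> crossing_out c < real (4 * base j + 4 * n + 4)"
    using u j c
  proof (cases rule: block_cases)
    case (1 l)
    then show ?thesis
      using position_unit[OF u j] base_bound[OF j] by (auto simp: is_crossing_def crossing_in_def crossing_out_def)
  next
    case (2 l)
    then show ?thesis
      using position_unit[OF u j] base_bound[OF j] by (auto simp: is_crossing_def crossing_in_def crossing_out_def)
  qed
  then show "is_crossing g c" "real (4 * base j) + 1 < crossing_in c" "crossing_out c < real (4 * base j + 4 * n + 4)"
    by auto
qed

lemma block_nonempty: "u \<in> indices \<Longrightarrow> j \<le> k \<Longrightarrow> block u j \<noteq> []"
  using depth_bounds(1)[of u j] by (simp add: block_def)

lemma crossing_list_crossings:
  assumes u: "u \<in> indices"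
  shows "crossing_list g (crossings u)"
  unfolding crossing_list_def
proof (intro conjI ballI)
  show "crossings u \<noteq> []"
  proof -
    have "set (block u 0) \<subseteq> set (crossings u)" by (auto simp: set_crossings)
    then show ?thesis using block_nonempty[OF u, of 0] by auto
  qed
  show "is_crossing g c" if "c \<in> set (crossings u)" for c
    using that block_crossing(1)[OF u] unfolding set_crossings by blast
  show "sorted_wrt (\<lambda>c c'. crossing_out c < crossing_in c') (crossings u)"
    unfolding crossings_def
  proof (rule sorted_wrt_concat_map)
    fix j assume "j < Suc k"
    then have j: "j \<le> k" by simp
    have "sorted_wrt (\<lambda>c c'. crossing_out c < crossing_in c')
        (map (\<lambda>l. (4 * (base j + l) + 1, position u j)) [0..<depth u j])"
      using position_unit[OF u j]
      by (simp add: sorted_wrt_iff_nth_less crossing_in_def crossing_out_def)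
    moreover have "crossing_out c < crossing_in (4 * (base j + depth u j), position u j)"
      if c: "c \<in> set (map (\<lambda>l. (4 * (base j + l) + 1, position u j)) [0..<depth u j])" for c
    proof -
      obtain l where "l < depth u j" "c = (4 * (base j + l) + 1, position u j)" using c by auto
      then show ?thesis
        using position_unit[OF u j] by (simp add: crossing_in_def crossing_out_def)
    qed
    ultimately show "sorted_wrt (\<lambda>c c'. crossing_out c < crossing_in c') (block u j)"
      unfolding block_def sorted_wrt_append by simp
  next
    fix i j c d assume ij: "i < j" "j < Suc k" and "c \<in> set (block u i)" "d \<in> set (block u j)"
    then have "crossing_out c < real (4 * base i + 4 * n + 4)" "real (4 * base j) + 1 < crossing_in d"
      using block_crossing[OF u] by auto
    moreover have "4 * base i + 4 * n + 4 \<le> 4 * base j" using base_mono[OF ij(1)] by simp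
    ultimately show "crossing_out c < crossing_in d" by linarith
  qed
qed

lemma crossings_disjoint:
  assumes u: "u \<in> indices" and v: "v \<in> indices" and "u \<noteq> v"
  shows "set (crossings u) \<inter> set (crossings v) = {}"
proof (rule ccontr)
  assume "\<not> ?thesis"
  then obtain c i j where i: "i \<le> k" "c \<in> set (block u i)" and j: "j \<le> k" "c \<in> set (block v j)"
    by (auto simp: set_crossings)
  obtain l where l: "l \<le> n" "snd c = position u i" "fst c div 4 = base i + l"
    using u i by (cases rule: block_cases) auto
  obtain l' where l': "l' \<le> n" "snd c = position v j" "fst c div 4 = base j + l'"
    using v j by (cases rule: block_cases) auto
  have "i = j" using base_unique[of i l j l'] l l' by simp
  then show False using position_neq[OF assms, of j] l(2) l'(2) by metis
qed

section \<open>Handles passed by a loop, and homotopy classes\<close>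

definition passes :: "(nat \<Rightarrow> nat) \<Rightarrow> nat \<Rightarrow> bool" where
  "passes u l \<longleftrightarrow> (\<exists>c\<in>set (crossings u). fst c = 4 * l + 1)"

text \<open>The handles passed in a block form an initial segment. The additional crossing of the
  twisted block is on a side divisible by 4 and does not count.\<close>

lemma passes_iff:
  assumes u: "u \<in> indices" and j: "j \<le> k" and l: "l \<le> n"
  shows "passes u (base j + l) \<longleftrightarrow> l < depth u j"
proof
  assume "passes u (base j + l)"
  then obtain c i where i: "i \<le> k" "c \<in> set (block u i)" "fst c = 4 * (base j + l) + 1"
    by (auto simp: passes_def set_crossings)
  then have odd: "fst c mod 4 = 1" by simp
  have "\<exists>l'<depth u i. c = (4 * (base i + l') + 1, position u i)"
    using i(2) unfolding set_block
  proof (elim disjE conjE)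
    assume "c = (4 * (base i + depth u i), position u i)"
    then have "fst c mod 4 = 0" by simp
    then show ?thesis using odd by simp
  qed
  then obtain l' where l': "l' < depth u i" "4 * (base i + l') + 1 = 4 * (base j + l) + 1"
    using i(3) by auto
  then have "base i + l' = base j + l" by simp
  then have "i = j \<and> l' = l"
    using depth_bounds[OF u i(1)] l l' by (intro base_unique) auto
  then show "l < depth u j" using l' by simp
next
  assume "l < depth u j"
  then have "(4 * (base j + l) + 1, position u j) \<in> set (crossings u)"
    using j unfolding set_crossings by (intro UN_I[of j]) (auto simp only: set_block atMost_iff)
  then show "passes u (base j + l)"
    unfolding passes_def by (intro bexI[of _ "(4 * (base j + l) + 1, position u j)"]) simp_all
qed

text \<open>In a block where the depths differ, the handle numbered by the smaller depth is passed
  by the deeper loop only.\<close>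

lemma passes_differ:
  assumes u: "u \<in> indices" and v: "v \<in> indices" and "u \<noteq> v"
  obtains l where "l < g" "passes u l \<noteq> passes v l"
proof -
  obtain j where j: "j \<le> k" "u j \<noteq> v j"
    using PiE_ext[OF u v] assms(3) by auto
  then have d: "depth u j \<noteq> depth v j"
    using index_less[OF u j(1)] index_less[OF v j(1)] by (auto simp: depth_def)
  define l where "l = min (depth u j) (depth v j)"
  have "l \<le> n" using depth_bounds[OF u j(1)] by (simp add: l_def)
  then have "passes u (base j + l) \<noteq> passes v (base j + l)"
    using passes_iff[OF u j(1)] passes_iff[OF v j(1)] d by (auto simp: l_def)
  moreover have "base j + l < g" using base_bound[OF j(1)] \<open>l \<le> n\<close> by simp
  ultimately show ?thesis using that by blast
qed

abbreviation loop :: "(nat \<Rightarrow> nat) \<Rightarrow> complex set set" where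
  "loop u \<equiv> crossing_loop g (crossings u)"

lemma loop_logarithm:
  assumes u: "u \<in> indices" and l: "l < g"
    and F: "\<And>z. norm z \<le> 1 \<Longrightarrow> F (surface_proj g z) = exp (\<i> * complex_of_real (height g l z))"
  shows "has_logarithm (genus_surface g) F (loop u) \<longleftrightarrow> \<not> passes u l"
  using crossing_loop_logarithm[OF crossing_list_crossings[OF u] l _ F]
    crossing_loop_no_logarithm[OF crossing_list_crossings[OF u] l _ _ F]
  unfolding passes_def by blast

text \<open>Invariance of the logarithm is applied in both directions, since either loop may be the
  one that passes handle \<open>l\<close>.\<close>

lemma loops_not_homotopic:
  assumes u: "u \<in> indices" and v: "v \<in> indices" and "u \<noteq> v"
  shows "\<not> homotopic_simple_loops (genus_surface g) (loop u) (loop v)"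
proof
  assume hom: "homotopic_simple_loops (genus_surface g) (loop u) (loop v)"
  then have hom': "homotopic_simple_loops (genus_surface g) (loop v) (loop u)"
    by (auto simp: homotopic_simple_loops_def intro: homotopic_with_symD)
  obtain l where l: "l < g" "passes u l \<noteq> passes v l"
    using passes_differ[OF assms] by blast
  obtain F where F: "continuous_map (genus_surface g) (top_of_set (sphere 0 1)) F"
    "\<And>z. norm z \<le> 1 \<Longrightarrow> F (surface_proj g z) = exp (\<i> * complex_of_real (height g l z))"
    using surface_circle_map[OF l(1)] by blast
  show False
    using homotopic_simple_loops_logarithm[OF Hausdorff_genus_surface[OF g_pos] F(1) hom]
      homotopic_simple_loops_logarithm[OF Hausdorff_genus_surface[OF g_pos] F(1) hom']
      loop_logarithm[OF u l(1) F(2)] loop_logarithm[OF v l(1) F(2)] l(2) by blast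
qed

lemma passes_0: "u \<in> indices \<Longrightarrow> passes u 0"
  using passes_iff[of u 0 0] depth_bounds[of u 0] by (simp add: base_def)

lemma loop_not_homotopic_side:
  assumes u: "u \<in> indices"
  shows "\<not> homotopic_simple_loops (genus_surface g) (loop u) (side_loop g 0)"
proof
  assume hom: "homotopic_simple_loops (genus_surface g) (loop u) (side_loop g 0)"
  obtain F where F: "continuous_map (genus_surface g) (top_of_set (sphere 0 1)) F"
    "\<And>z. norm z \<le> 1 \<Longrightarrow> F (surface_proj g z) = exp (\<i> * complex_of_real (height g 0 z))"
    using surface_circle_map[OF g_pos] by blast
  show False
    using homotopic_simple_loops_logarithm[OF Hausdorff_genus_surface[OF g_pos] F(1) hom]
      side_loop_logarithm[OF g_pos F(2)] loop_logarithm[OF u g_pos F(2)] passes_0[OF u] by blast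
qed

lemma loop_Int_side:
  assumes u: "u \<in> indices"
  shows "\<exists>x. loop u \<inter> side_loop g 0 = {x}"
proof -
  have "{c \<in> set (crossings u). fst c = 4 * 0 + 1} = {(1, position u 0)}"
  proof (intro equalityI subsetI)
    fix c assume c: "c \<in> {c \<in> set (crossings u). fst c = 4 * 0 + 1}"
    then obtain j where j: "j \<le> k" "c \<in> set (block u j)" by (auto simp: set_crossings)
    from u j have "base j + 0 = base 0 + 0 \<and> snd c = position u j"
      using c by (cases rule: block_cases) (auto simp: base_def)
    then have "j = 0 \<and> snd c = position u j" using base_unique[of j 0 0 0] by auto
    then show "c \<in> {(1, position u 0)}" using c by (auto simp: prod_eq_iff)
  next
    fix c assume "c \<in> {(1::nat, position u 0)}"
    then show "c \<in> {c \<in> set (crossings u). fst c = 4 * 0 + 1}"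
      using depth_bounds(1)[OF u, of 0] by (auto simp: set_crossings set_block base_def intro!: bexI[of _ 0])
  qed
  then show ?thesis
    using crossing_loop_Int_side_loop[OF crossing_list_crossings[OF u] g_pos] by auto
qed

text \<open>The value at \<open>Suc k\<close> is the return to block \<open>0\<close>, shifted by
  the period \<open>4 * g\<close> so that the last link is an increasing pair like the
  others.\<close>

definition entry :: "(nat \<Rightarrow> nat) \<Rightarrow> nat \<Rightarrow> real" where
  "entry u j = (if j \<le> k then real (4 * base j + 1) + position u j else real (4 * g + 1) + position u 0)"

text \<open>This is \<open>crossing_out\<close> of the last crossing of the block. It lies on the
  last side of handle \<open>depth u j - 1\<close> of the block or, after the additional crossing,
  on the third side of the next handle.\<close>

definition exit :: "(nat \<Rightarrow> nat) \<Rightarrow> nat \<Rightarrow> real" where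
  "exit u j = real (4 * (base j + depth u j)) + (if twisted j then 3 else 0) - position u j"

definition inner_chord :: "(nat \<Rightarrow> nat) \<Rightarrow> nat \<Rightarrow> nat \<Rightarrow> real \<times> real \<Rightarrow> bool" where
  "inner_chord u j l c \<longleftrightarrow> 0 < l \<and> fst c = real (4 * (base j + l)) - position u j \<and>
     (l < depth u j \<and> snd c = real (4 * (base j + l) + 1) + position u j \<or>
      twisted j \<and> l = depth u j \<and> snd c = real (4 * (base j + l)) + position u j)"

lemma loop_chord_cases:
  assumes u: "u \<in> indices" and t: "t < length (crossings u)"
  obtains (inner) j l where "j \<le> k" "inner_chord u j l (loop_chord g (crossings u) t)"
    | (link) j where "j \<le> k" "loop_chord g (crossings u) t = (exit u j, entry u (Suc j))"
proof -
  have hd_block: "crossing_in (hd (block u j)) = entry u j" if "j \<le> k" for j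
    using depth_bounds[OF u that] that
    by (auto simp: block_def entry_def crossing_in_def hd_append upt_conv_Cons)
  \<comment> \<open>\<open>set_gaps_concat\<close> expects nonempty lists at all indices; beyond
    \<open>k\<close>, outside the concatenated range, the last block is repeated.\<close>
  define blk where "blk j = block u (min j k)" for j
  have blk: "blk j \<noteq> []" for j using block_nonempty[OF u] by (simp add: blk_def)
  have cr: "crossings u = concat (map blk [0..<Suc k])"
    unfolding crossings_def by (rule arg_cong[where f = concat], rule map_cong) (auto simp: blk_def)
  have "crossings u ! 0 = hd (block u 0)"
    using block_nonempty[OF u, of 0] unfolding crossings_def
    by (simp add: upt_conv_Cons hd_conv_nth nth_append del: upt_Suc)
  then have e: "4 * real g + crossing_in (crossings u ! 0) = entry u (Suc k)"
    using hd_block[of 0] by (simp add: entry_def base_def)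
  have in_gaps: "loop_chord g (crossings u) t \<in> set (gaps (concat (map blk [0..<Suc k])) (entry u (Suc k)))"
    using loop_chord_in_gaps[OF t, of g] e cr by simp
  have "\<exists>j\<le>k. loop_chord g (crossings u) t \<in> set (gaps (block u j) (entry u (Suc j)))"
  proof -
    have "crossing_in (hd (blk (Suc i))) = entry u (Suc i)" "blk i = block u i" if "i < k" for i
      using hd_block[of "Suc i"] that by (simp_all add: blk_def)
    then show ?thesis
      using in_gaps unfolding set_gaps_concat[of blk, OF blk]
      by (auto simp: blk_def intro: less_imp_le)
  qed
  then obtain j where j: "j \<le> k" "loop_chord g (crossings u) t \<in> set (gaps (block u j) (entry u (Suc j)))"
    by blast
  obtain d where d: "depth u j = Suc d" using depth_bounds[OF u j(1)] by (cases "depth u j") auto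
  define c where "c l = (4 * (base j + l) + 1, position u j)" for l
  have m: "map (\<lambda>l. (4 * (base j + l) + 1, position u j)) [0..<depth u j] = map c [0..<Suc d]"
    by (simp add: c_def d)
  show ?thesis
  proof (cases "twisted j")
    case False
    then have "set (gaps (block u j) (entry u (Suc j))) =
        (\<lambda>l. (crossing_out (c l), crossing_in (c (Suc l)))) ` {..<d} \<union> {(crossing_out (c d), entry u (Suc j))}"
      unfolding block_def m by (simp only: if_False append_Nil2 set_gaps_map)
    then consider l where "l < d" "loop_chord g (crossings u) t = (crossing_out (c l), crossing_in (c (Suc l)))"
      | "loop_chord g (crossings u) t = (crossing_out (c d), entry u (Suc j))"
      using j(2) by auto
    then show ?thesis
    proof cases
      case (1 l)
      then show ?thesis
        using d by (intro inner[OF j(1), of "Suc l"])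
          (auto simp: inner_chord_def c_def crossing_in_def crossing_out_def)
    next
      case 2
      then show ?thesis
        using d False by (intro link[OF j(1)]) (auto simp: exit_def c_def crossing_out_def)
    qed
  next
    case True
    define a where "a = (4 * (base j + depth u j), position u j)"
    have "gaps (block u j) (entry u (Suc j)) = gaps (map c [0..<Suc d]) (crossing_in a) @ [(crossing_out a, entry u (Suc j))]"
      unfolding block_def m using True by (simp add: gaps_append a_def del: upt_Suc)
    then have "set (gaps (block u j) (entry u (Suc j))) =
        (\<lambda>l. (crossing_out (c l), crossing_in (c (Suc l)))) ` {..<d} \<union> {(crossing_out (c d), crossing_in a)} \<union>
        {(crossing_out a, entry u (Suc j))}"
      by (simp only: set_append set_gaps_map list.set)
    then consider l where "l < d" "loop_chord g (crossings u) t = (crossing_out (c l), crossing_in (c (Suc l)))"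
      | "loop_chord g (crossings u) t = (crossing_out (c d), crossing_in a)"
      | "loop_chord g (crossings u) t = (crossing_out a, entry u (Suc j))"
      using j(2) by auto
    then show ?thesis
    proof cases
      case (1 l)
      then show ?thesis
        using d by (intro inner[OF j(1), of "Suc l"])
          (auto simp: inner_chord_def c_def crossing_in_def crossing_out_def)
    next
      case 2
      then show ?thesis
        using d True by (intro inner[OF j(1), of "Suc d"])
          (auto simp: inner_chord_def c_def a_def crossing_in_def crossing_out_def)
    next
      case 3
      then show ?thesis
        using d True by (intro link[OF j(1)]) (auto simp: exit_def a_def crossing_out_def)
    qed
  qed
qed

section \<open>Pairs of chords that cannot meet\<close>

lemma base_real_mono: "i < j \<Longrightarrow> real (base i) + real n + 1 \<le> real (base j)"
  using base_mono[of i j] by linarith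

lemma entry_bounds:
  assumes u: "u \<in> indices" and j: "j \<le> Suc k"
  shows "4 * real (base j) + 1 < entry u j" "entry u j < 4 * real g + 2"
proof -
  have "4 * real (base j) + 1 < entry u j \<and> entry u j < 4 * real g + 2"
  proof (cases "j = Suc k")
    case True
    then show ?thesis using position_unit[OF u, of 0] base_last by (simp add: entry_def)
  next
    case False
    then have "j \<le> k" using j by simp
    then show ?thesis using position_unit[OF u, of j] base_bound[of j] by (simp add: entry_def)
  qed
  then show "4 * real (base j) + 1 < entry u j" "entry u j < 4 * real g + 2" by auto
qed

lemma entry_upper: "u \<in> indices \<Longrightarrow> j \<le> k \<Longrightarrow> entry u j < 4 * real (base j) + 2"
  using position_unit[of u j] by (simp add: entry_def)

lemma exit_bounds:
  assumes u: "u \<in> indices" and j: "j \<le> k"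
  shows "4 * real (base j) + 3 < exit u j" "exit u j < 4 * real (base j) + 4 * real n + 3"
proof -
  have "1 \<le> real (depth u j)" "real (depth u j) \<le> real n" using depth_bounds[OF u j] by simp_all
  then show "4 * real (base j) + 3 < exit u j" "exit u j < 4 * real (base j) + 4 * real n + 3"
    using position_unit[OF u j] unfolding exit_def by auto
qed

text \<open>For \<open>i = j\<close>: the links of any two loops over the same gap start before
  either of them ends. They are never separated, so equal order at both ends means interleaving and
  opposite order means nesting.\<close>

lemma exit_less_entry:
  assumes u: "u \<in> indices" and v: "v \<in> indices" and ij: "i \<le> j" "j \<le> k"
  shows "exit u i < entry v (Suc j)"
  using exit_bounds(2)[OF u, of i] entry_bounds(1)[OF v, of "Suc j"] base_real_mono[of i "Suc j"] ij by simp

lemma inner_chord_span: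
  assumes u: "u \<in> indices" and j: "j \<le> k" and c: "inner_chord u j l c"
  shows "1 \<le> l" "l \<le> n" "4 * real (base j + l) - 1 < fst c" "fst c < snd c" "snd c < 4 * real (base j + l) + 2"
  using c depth_bounds[OF u j] position_unit[OF u j] by (auto simp: inner_chord_def)

text \<open>Chords towards different handles use disjoint parameter ranges; towards the same handle
  they are nested by position. A chord to the additional crossing stays inside those of deeper
  loops, whose positions are larger in the twisted block.\<close>

lemma inner_chords_disjoint:
  assumes u: "u \<in> indices" and v: "v \<in> indices" and "u \<noteq> v" and i: "i \<le> k" and j: "j \<le> k"
    and c: "inner_chord u i l c" and d: "inner_chord v j l' d"
  shows "polygon_chord g c \<inter> polygon_chord g d = {}"
proof -
  note C = inner_chord_span[OF u i c] and D = inner_chord_span[OF v j d]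
  have sep: "x < y" if "x < 4 * p + 2" "p + 1 \<le> q" "4 * q - 1 < y" for x y p q :: real
    using that by linarith
  have "2 < fst c" "2 < fst d" using C D by auto
  moreover have "base i + l < g" "base j + l' < g" using base_bound i j C D by fastforce+
  then have "real (base i + l) + 1 \<le> real g" "real (base j + l') + 1 \<le> real g" by simp_all
  then have "snd c < 4 * real g + 2" "snd d < 4 * real g + 2" using C(5) D(5) by simp_all
  moreover have "snd c < fst d \<or> snd d < fst c \<or> (fst c < fst d \<and> snd d < snd c) \<or> (fst d < fst c \<and> snd c < snd d)"
  proof (cases "base i + l" "base j + l'" rule: linorder_cases)
    case less
    then have "real (base i + l) + 1 \<le> real (base j + l')" by linarith
    then have "snd c < fst d" using sep[OF C(5) _ D(3)] by blast
    then show ?thesis by simp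
  next
    case greater
    then have "real (base j + l') + 1 \<le> real (base i + l)" by linarith
    then have "snd d < fst c" using sep[OF D(5) _ C(3)] by blast
    then show ?thesis by simp
  next
    case equal
    then have e: "i = j" "l = l'" using base_unique[of i l j l'] C D by auto
    define x p q where "x = real (4 * (base j + l'))" and "p = position u j" and "q = position v j"
    have c': "fst c = x - p" "l' < depth u j \<and> snd c = x + 1 + p \<or> twisted j \<and> l' = depth u j \<and> snd c = x + p"
      using c unfolding inner_chord_def e x_def p_def by (simp, force)
    have d': "fst d = x - q" "l' < depth v j \<and> snd d = x + 1 + q \<or> twisted j \<and> l' = depth v j \<and> snd d = x + q"
      using d unfolding inner_chord_def x_def q_def by (simp, force)
    have pq: "0 < p" "p < 1" "0 < q" "q < 1" "p \<noteq> q"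
      using position_unit[OF u j] position_unit[OF v j] position_neq[OF u v \<open>u \<noteq> v\<close>, of j]
      unfolding p_def q_def by simp_all
    have deeper: "p < q" if "twisted j" "depth u j < depth v j"
      using position_less[OF u v, of j] that by (simp add: depth_def p_def q_def)
    have deeper': "q < p" if "twisted j" "depth v j < depth u j"
      using position_less[OF v u, of j] that by (simp add: depth_def p_def q_def)
    have "(fst c < fst d \<and> snd d < snd c) \<or> (fst d < fst c \<and> snd c < snd d)"
      using c'(2) d'(2)
    proof (elim disjE conjE)
      assume "snd c = x + 1 + p" "snd d = x + 1 + q"
      then show ?thesis using c'(1) d'(1) pq by (cases "p < q") auto
    next
      assume "snd c = x + p" "snd d = x + q"
      then show ?thesis using c'(1) d'(1) pq by (cases "p < q") auto
    next
      assume "l' < depth u j" "twisted j" "l' = depth v j" "snd c = x + 1 + p" "snd d = x + q"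
      then show ?thesis using c'(1) d'(1) pq deeper' by auto
    next
      assume "l' < depth v j" "twisted j" "l' = depth u j" "snd c = x + p" "snd d = x + 1 + q"
      then show ?thesis using c'(1) d'(1) pq deeper by auto
    qed
    then show ?thesis by simp
  qed
  ultimately show ?thesis
    using C D g_pos by (intro chords_disjoint) auto
qed

text \<open>Neither end of the link falls into the range of the inner chord, so the two are nested
  or separated. The delicate case is an ordinary block in which \<open>v\<close> leaves just before
  the handle that \<open>u\<close> goes on to: there \<open>u\<close> has the smaller position, so
  its chord starts after the exit of \<open>v\<close>.\<close>

lemma inner_link_disjoint:
  assumes u: "u \<in> indices" and v: "v \<in> indices" and "u \<noteq> v" and i: "i \<le> k" and j: "j \<le> k"
    and c: "inner_chord u i l c"
  shows "polygon_chord g c \<inter> polygon_chord g (exit v j, entry v (Suc j)) = {}"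
proof -
  note C = inner_chord_span[OF u i c]
  have l: "1 \<le> real l" "real l \<le> real n" using C by simp_all
  have "2 < fst c" using C by auto
  moreover have "real (base i) + real n + 1 \<le> real g" using base_bound[OF i] by linarith
  then have "snd c < 4 * real g + 2" using C l by simp
  moreover have ent: "entry v (Suc j) < fst c \<or> snd c < entry v (Suc j)"
  proof (cases "Suc j \<le> i")
    case True
    then have "real (base (Suc j)) \<le> real (base i)" using base_real_mono[of "Suc j" i] by (cases "Suc j = i") auto
    then show ?thesis using entry_upper[OF v, of "Suc j"] True i C l by simp
  next
    case False
    then show ?thesis
      using base_real_mono[of i "Suc j"] entry_bounds(1)[OF v, of "Suc j"] j C l by simp
  qed
  moreover have "exit v j < fst c \<or> snd c < exit v j"
  proof (cases i j rule: linorder_cases)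
    case greater
    then show ?thesis using base_real_mono[of j i] exit_bounds(2)[OF v j] C l by simp
  next
    case less
    then show ?thesis using base_real_mono[of i j] exit_bounds(1)[OF v j] C l by simp
  next
    case equal
    have pos: "0 < position u j" "position u j < 1" "0 < position v j" "position v j < 1"
      using position_unit[OF u j] position_unit[OF v j] by auto
    consider "depth v j < l" | "depth v j = l" | "l < depth v j" by linarith
    then show ?thesis
    proof cases
      case 1
      then have "real (depth v j) + 1 \<le> real l" by linarith
      then show ?thesis using C pos equal by (auto simp: exit_def)
    next
      case 3
      then have "real l + 1 \<le> real (depth v j)" by linarith
      then show ?thesis using C pos equal by (auto simp: exit_def)
    next
      case 2
      show ?thesis
      proof (cases "twisted j")
        case True
        then show ?thesis using C pos equal 2 by (auto simp: exit_def)
      next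
        case False
        then have "depth v j < depth u j" using c equal 2 by (auto simp: inner_chord_def)
        then have "u j < v j" using False by (auto simp: depth_def)
        from position_less[OF u v this] show ?thesis
          using c equal 2 False by (auto simp: exit_def inner_chord_def)
      qed
    qed
  qed
  moreover have "exit v j < entry v (Suc j)" using exit_less_entry[OF v v] j by simp
  ultimately show ?thesis
    using C g_pos exit_bounds(1)[OF v j] entry_bounds(2)[OF v, of "Suc j"] j
    by (intro chords_disjoint) auto
qed

lemma links_disjoint:
  assumes u: "u \<in> indices" and v: "v \<in> indices" and ij: "i < j" "j \<le> k"
  shows "polygon_chord g (exit u i, entry u (Suc i)) \<inter> polygon_chord g (exit v j, entry v (Suc j)) = {}"
proof -
  have "real (base (Suc i)) \<le> real (base j)"
    using base_real_mono[of "Suc i" j] ij by (cases "Suc i = j") auto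
  moreover have "entry u (Suc i) < 4 * real (base (Suc i)) + 2" using entry_upper[OF u, of "Suc i"] ij by simp
  ultimately have "entry u (Suc i) < exit v j" using exit_bounds(1)[OF v ij(2)] by simp
  then show ?thesis
    using exit_bounds(1)[OF u, of i] exit_bounds(1)[OF v, of j] entry_bounds(2)[OF u, of "Suc i"]
      entry_bounds(2)[OF v, of "Suc j"] exit_less_entry[OF u u, of i i] exit_less_entry[OF v v, of j j] ij g_pos
    by (intro chords_disjoint) auto
qed

section \<open>Parity of the crossing links\<close>

definition crossing_links :: "(nat \<Rightarrow> nat) \<Rightarrow> (nat \<Rightarrow> nat) \<Rightarrow> nat \<Rightarrow> bool" where
  "crossing_links u v j \<longleftrightarrow> (exit u j < exit v j \<longleftrightarrow> entry u (Suc j) < entry v (Suc j))"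

text \<open>A larger position means a smaller depth or, at equal depth, a departure further back;
  both move the exit down.\<close>

lemma exit_less:
  assumes u: "u \<in> indices" and v: "v \<in> indices" and j: "j \<le> k" "\<not> twisted j"
    and less: "position v j < position u j"
  shows "exit u j < exit v j"
proof -
  have "v j \<le> u j" using position_less_imp[OF v u less] .
  then have "depth u j \<le> depth v j" using j by (auto simp: depth_def)
  then have "real (depth u j) \<le> real (depth v j)" by simp
  then show ?thesis using j less by (auto simp: exit_def)
qed

lemma exit_less_iff:
  assumes u: "u \<in> indices" and v: "v \<in> indices" and "u \<noteq> v" and j: "j \<le> k" "\<not> twisted j"
  shows "exit u j < exit v j \<longleftrightarrow> position v j < position u j"
  using exit_less[OF u v j] exit_less[OF v u j] position_neq[OF assms(1-3), of j] by force

text \<open>A larger index now means a greater depth, and different depths put the exits into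
  different handles, so the order of the entries is kept instead of reversed. At equal depth it is
  still reversed, hence the assumption \<open>u j \<noteq> v j\<close>.\<close>

lemma exit_less_iff_twisted:
  assumes u: "u \<in> indices" and v: "v \<in> indices" and j: "j \<le> k" "twisted j" and "u j \<noteq> v j"
  shows "exit u j < exit v j \<longleftrightarrow> position u j < position v j"
proof -
  have *: "exit u j < exit v j \<and> position u j < position v j"
    if u: "u \<in> indices" and v: "v \<in> indices" and "u j < v j" for u v
  proof -
    have "real (depth u j) + 1 \<le> real (depth v j)" using \<open>u j < v j\<close> j by (simp add: depth_def)
    then have "exit u j < exit v j"
      using position_unit[OF u j(1)] position_unit[OF v j(1)] by (auto simp: exit_def)
    then show ?thesis using position_less[OF that] by simp
  qed
  from \<open>u j \<noteq> v j\<close> consider "u j < v j" | "v j < u j" by linarith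
  then show ?thesis using *[OF u v] *[OF v u] by cases auto
qed

lemma exit_neq:
  assumes u: "u \<in> indices" and v: "v \<in> indices" and "u \<noteq> v" and j: "j \<le> k"
  shows "exit u j \<noteq> exit v j"
proof (cases "twisted j \<and> u j \<noteq> v j")
  case True
  then show ?thesis
    using exit_less_iff_twisted[OF u v j] exit_less_iff_twisted[OF v u j] position_neq[OF assms(1-3), of j]
    by force
next
  case False
  then show ?thesis
    using exit_less_iff[OF assms(1-3) j] exit_less_iff[OF v u _ j] position_neq[OF assms(1-3), of j] \<open>u \<noteq> v\<close>
    by (cases "twisted j") (auto simp: exit_def depth_def)
qed

lemma entry_less_iff:
  "j \<le> k \<Longrightarrow> entry u (Suc j) < entry v (Suc j) \<longleftrightarrow>
    (if j = k then position u 0 < position v 0 else position u (Suc j) < position v (Suc j))"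
  by (auto simp: entry_def)

lemma entry_neq:
  assumes "u \<in> indices" "v \<in> indices" "u \<noteq> v"
  shows "entry u (Suc j) \<noteq> entry v (Suc j)"
  using position_neq[OF assms] by (auto simp: entry_def)

lemma uncrossed_links_disjoint:
  assumes u: "u \<in> indices" and v: "v \<in> indices" and "u \<noteq> v" and j: "j \<le> k"
    and "\<not> crossing_links u v j"
  shows "polygon_chord g (exit u j, entry u (Suc j)) \<inter> polygon_chord g (exit v j, entry v (Suc j)) = {}"
proof (rule chords_disjoint)
  have "exit u j < exit v j \<and> entry v (Suc j) < entry u (Suc j) \<or> exit v j < exit u j \<and> entry u (Suc j) < entry v (Suc j)"
    using assms(5) exit_neq[OF assms(1-4)] entry_neq[OF assms(1-3), of j] unfolding crossing_links_def by linarith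
  then show "snd (exit u j, entry u (Suc j)) < fst (exit v j, entry v (Suc j)) \<or>
      snd (exit v j, entry v (Suc j)) < fst (exit u j, entry u (Suc j)) \<or>
      fst (exit u j, entry u (Suc j)) < fst (exit v j, entry v (Suc j)) \<and>
      snd (exit v j, entry v (Suc j)) < snd (exit u j, entry u (Suc j)) \<or>
      fst (exit v j, entry v (Suc j)) < fst (exit u j, entry u (Suc j)) \<and>
      snd (exit u j, entry u (Suc j)) < snd (exit v j, entry v (Suc j))"
    by auto
qed (use exit_bounds(1)[OF u j] exit_bounds(1)[OF v j] entry_bounds(2)[OF u, of "Suc j"]
      entry_bounds(2)[OF v, of "Suc j"] exit_less_entry[OF u u, of j j] exit_less_entry[OF v v, of j j] j g_pos in auto)

lemma links_cross_at_most_once: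
  assumes u: "u \<in> indices" and v: "v \<in> indices" and "u \<noteq> v" and j: "j \<le> k"
    and z: "z \<in> polygon_chord g (exit u j, entry u (Suc j)) \<inter> polygon_chord g (exit v j, entry v (Suc j))"
    and w: "w \<in> polygon_chord g (exit u j, entry u (Suc j)) \<inter> polygon_chord g (exit v j, entry v (Suc j))"
  shows "z = w"
proof -
  have "crossing_links u v j"
    using uncrossed_links_disjoint[OF assms(1-4)] z by blast
  moreover have "4 * real (base j) + 3 < exit u j" "4 * real (base j) + 3 < exit v j"
    using exit_bounds j u v by auto
  moreover have "entry u (Suc j) < 4 * real g + 2" "entry v (Suc j) < 4 * real g + 2"
    using entry_bounds j u v by auto
  moreover have "exit u j < entry v (Suc j)" "exit v j < entry u (Suc j)"
    using exit_less_entry j u v by auto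
  moreover have "exit u j \<noteq> exit v j" "entry u (Suc j) \<noteq> entry v (Suc j)"
    using exit_neq[OF assms(1-4)] entry_neq[OF assms(1-3)] by auto
  ultimately consider
      "exit u j < exit v j" "exit v j < entry u (Suc j)" "entry u (Suc j) < entry v (Suc j)" "entry v (Suc j) < exit u j + 4 * real g"
    | "exit v j < exit u j" "exit u j < entry v (Suc j)" "entry v (Suc j) < entry u (Suc j)" "entry u (Suc j) < exit v j + 4 * real g"
    unfolding crossing_links_def by (cases "exit u j < exit v j") auto
  then show ?thesis
    using chords_cross_at_most_once[OF g_pos] z w by cases blast+
qed

lemma not_all_links_cross:
  assumes u: "u \<in> indices" and v: "v \<in> indices" and "u \<noteq> v"
  shows "\<exists>j\<le>k. \<not> crossing_links u v j"
proof (rule ccontr)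
  assume "\<not> ?thesis"
  then have all: "crossing_links u v j" if "j \<le> k" for j using that by blast
  define \<sigma> where "\<sigma> j \<longleftrightarrow> position u j < position v j" for j
  have ord: "exit u j < exit v j \<longleftrightarrow> \<not> \<sigma> j" if "j \<le> k" "\<not> twisted j" for j
    using exit_less_iff[OF assms that] position_neq[OF assms, of j] by (auto simp: \<sigma>_def)
  \<comment> \<open>Exits reverse the order of positions, and a crossing link carries this reversed
    order into the next block.\<close>
  have alt: "\<sigma> (Suc j) \<longleftrightarrow> \<not> \<sigma> j" if "j < k" for j
    using all[of j] ord[of j] that entry_less_iff[of j u v] unfolding crossing_links_def
    by (auto simp: \<sigma>_def twisted_def)
  have \<sigma>: "\<sigma> j \<longleftrightarrow> (even j \<longleftrightarrow> \<sigma> 0)" if "j \<le> k" for j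
    using that by (induction j) (auto simp: alt)
  \<comment> \<open>The last link leads back to block \<open>0\<close>; if it crosses, the order
    there dictates the order of the exits from block \<open>k\<close>.\<close>
  have last: "exit u k < exit v k \<longleftrightarrow> \<sigma> 0"
    using all[of k] entry_less_iff[of k u v] unfolding crossing_links_def by (auto simp: \<sigma>_def)
  show False
  proof (cases "twisted k")
    case False
    then show False using last ord[of k] \<sigma>[of k] by (auto simp: twisted_def)
  next
    case True
    then have k: "odd k" by (simp add: twisted_def)
    show False
    proof (cases "u k = v k")
      \<comment> \<open>At equal depth the twisted block has no twisting effect on this pair. The
        offset helps instead: it copies the order of block \<open>0\<close>, so
        \<open>\<sigma> k\<close> equals \<open>\<sigma> 0\<close>, while an odd number of
        alternations yields the opposite.\<close>
      case True
      have "\<not> twisted 0" using k by (simp add: twisted_def odd_pos)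
      then have "\<sigma> k \<longleftrightarrow> \<sigma> 0"
        using True \<open>twisted k\<close> n by (simp add: \<sigma>_def position_def offset_def divide_less_cancel)
      then show False using \<sigma>[of k] k by simp
    next
      case False
      then have "exit u k < exit v k \<longleftrightarrow> \<sigma> k"
        using exit_less_iff_twisted[OF u v, of k] True by (simp add: \<sigma>_def)
      then show False using last \<sigma>[of k] k by simp
    qed
  qed
qed

lemma loops_Int:
  assumes u: "u \<in> indices" and v: "v \<in> indices" and "u \<noteq> v"
  shows "finite (loop u \<inter> loop v) \<and> card (loop u \<inter> loop v) \<le> k"
proof -
  define L where "L j = polygon_chord g (exit u j, entry u (Suc j)) \<inter> polygon_chord g (exit v j, entry v (Suc j))" for j
  \<comment> \<open>Only these blocks contribute intersection points, at most one each, and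
    \<open>J\<close> is a proper subset of \<open>{..k}\<close>.\<close>
  define J where "J = {j. j \<le> k \<and> crossing_links u v j}"
  have chords: "polygon_chord g (loop_chord g (crossings u) s) \<inter> polygon_chord g (loop_chord g (crossings v) t) \<subseteq> (\<Union>j\<in>J. L j)"
    if s: "s < length (crossings u)" and t: "t < length (crossings v)" for s t
    using u s
  proof (cases rule: loop_chord_cases)
    case c: (inner i l)
    show ?thesis
      using v t
    proof (cases rule: loop_chord_cases)
      case d: (inner j l')
      show ?thesis using inner_chords_disjoint[OF assms c(1) d(1) c(2) d(2)] by simp
    next
      case d: (link j)
      show ?thesis using inner_link_disjoint[OF assms c(1) d(1) c(2)] d(2) by simp
    qed
  next
    case c: (link i)
    show ?thesis
      using v t
    proof (cases rule: loop_chord_cases)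
      case d: (inner j l)
      show ?thesis using inner_link_disjoint[OF v u _ d(1) c(1) d(2)] c(2) \<open>u \<noteq> v\<close> by auto
    next
      case d: (link j)
      consider "i < j" | "j < i" | "i = j" by linarith
      then show ?thesis
      proof cases
        case 1
        then show ?thesis using links_disjoint[OF u v _ d(1)] c d by simp
      next
        case 2
        then show ?thesis using links_disjoint[OF v u _ c(1)] c d by auto
      next
        case 3
        then show ?thesis
          using uncrossed_links_disjoint[OF assms d(1)] c d by (cases "crossing_links u v j") (auto simp: J_def L_def)
      qed
    qed
  qed
  note crossing_loop_Int[OF crossing_list_crossings[OF u] crossing_list_crossings[OF v] crossings_disjoint[OF assms]]
  also have "(\<Union>s<length (crossings u). \<Union>t<length (crossings v). surface_proj g `
      (polygon_chord g (loop_chord g (crossings u) s) \<inter> polygon_chord g (loop_chord g (crossings v) t))) \<subseteq>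
      surface_proj g ` (\<Union>j\<in>J. L j)"
    by (intro UN_least image_mono chords) simp_all
  finally have sub: "loop u \<inter> loop v \<subseteq> (\<Union>j\<in>J. surface_proj g ` L j)"
    by (simp only: image_UN)
  have J: "finite J" "card J \<le> k"
  proof -
    have "J \<subset> {..k}" using not_all_links_cross[OF assms] by (auto simp: J_def)
    then show "finite J" "card J \<le> k"
      using psubset_card_mono[of "{..k}" J] finite_subset[of J "{..k}"] by auto
  qed
  have L: "finite (surface_proj g ` L j) \<and> card (surface_proj g ` L j) \<le> 1" if "j \<in> J" for j
  proof -
    have "\<exists>z. L j \<subseteq> {z}"
      using links_cross_at_most_once[OF assms, of j] that unfolding L_def J_def by blast
    then obtain z where z: "surface_proj g ` L j \<subseteq> {surface_proj g z}" by blast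
    then show ?thesis using finite_subset[OF z] card_mono[OF _ z] by simp
  qed
  have "card (\<Union>j\<in>J. surface_proj g ` L j) \<le> (\<Sum>j\<in>J. card (surface_proj g ` L j))"
    by (rule card_UN_le[OF J(1)])
  also have "\<dots> \<le> (\<Sum>j\<in>J. 1)" using L by (intro sum_mono) auto
  also have "\<dots> \<le> k" using J by simp
  finally have "card (\<Union>j\<in>J. surface_proj g ` L j) \<le> k" .
  moreover have fin: "finite (\<Union>j\<in>J. surface_proj g ` L j)" using J L by auto
  ultimately show ?thesis using sub card_mono[OF fin sub] finite_subset[OF sub fin] by auto
qed

section \<open>The resulting systems and their size\<close>

lemma simple_loop_loop: "u \<in> indices \<Longrightarrow> simple_loop (genus_surface g) (loop u)"
  by (intro simple_loop_crossing_loop crossing_list_crossings)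

text \<open>Equal loops would be homotopic, as every simple loop is homotopic to itself. Counting
  index functions therefore counts loops.\<close>

lemma inj_on_loop: "inj_on loop indices"
proof (rule inj_onI, rule ccontr)
  fix u v assume uv: "u \<in> indices" "v \<in> indices" "loop u = loop v" "u \<noteq> v"
  show False
    using loops_not_homotopic[OF uv(1,2,4)] homotopic_simple_loops_refl[OF simple_loop_loop[OF uv(1)]] uv(3)
    by simp
qed

lemma card_loops: "finite (loop ` indices)" "card (loop ` indices) = n ^ (k + 1)"
  using card_image[OF inj_on_loop] by (simp_all add: card_PiE finite_PiE)

lemma side_not_loop: "u \<in> indices \<Longrightarrow> side_loop g 0 \<noteq> loop u"
  using loop_not_homotopic_side[of u] homotopic_simple_loops_refl[OF simple_loop_loop[of u]] by auto

lemma k_system_loops: "k_system (genus_surface g) k (loop ` indices)"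
  unfolding k_system_def
proof (intro conjI ballI impI)
  show "simple_loop (genus_surface g) \<gamma>" if "\<gamma> \<in> loop ` indices" for \<gamma>
    using that simple_loop_loop by (elim imageE) simp
  fix \<gamma> \<delta> assume "\<gamma> \<in> loop ` indices" "\<delta> \<in> loop ` indices" and ne: "\<gamma> \<noteq> \<delta>"
  then obtain u v where u: "u \<in> indices" "\<gamma> = loop u" and v: "v \<in> indices" "\<delta> = loop v"
    by (elim imageE)
  have uv: "u \<noteq> v" using ne u v by auto
  show "\<not> homotopic_simple_loops (genus_surface g) \<gamma> \<delta>" "finite (\<gamma> \<inter> \<delta>)" "card (\<gamma> \<inter> \<delta>) \<le> k"
    using loops_not_homotopic[OF u(1) v(1) uv] loops_Int[OF u(1) v(1) uv] u(2) v(2) by simp_all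
qed

lemma k_system_hub:
  assumes "0 < k"
  shows "k_system (genus_surface g) k (insert (side_loop g 0) (loop ` indices))"
proof (rule k_system_insert[OF k_system_loops simple_loop_side_loop[OF g_pos]])
  fix \<delta> assume "\<delta> \<in> loop ` indices"
  then obtain u where u: "u \<in> indices" "\<delta> = loop u" by blast
  obtain x where "loop u \<inter> side_loop g 0 = {x}" using loop_Int_side[OF u(1)] by blast
  then show "\<not> homotopic_simple_loops (genus_surface g) \<delta> (side_loop g 0) \<and>
      finite (\<delta> \<inter> side_loop g 0) \<and> card (\<delta> \<inter> side_loop g 0) \<le> k"
    using loop_not_homotopic_side[OF u(1)] u(2) assms by simp
qed

end

theorem proposition4:
  fixes k :: nat
  shows "\<exists>c C :: real. c > 0 \<and> C > 0 \<and>
    (\<forall>g::nat. g \<ge> 2 \<longrightarrow>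
      (\<exists>\<Gamma>. k_system (genus_surface g) k \<Gamma> \<and> finite \<Gamma> \<and>
         c * real g ^ (k + 1) \<le> real (card \<Gamma>) \<and>
         real (card \<Gamma>) \<le> C * real g ^ (k + 1) \<and>
         (k > 0 \<longrightarrow> (\<exists>\<gamma>\<in>\<Gamma>. \<forall>\<delta>\<in>\<Gamma> - {\<gamma>}. \<gamma> \<inter> \<delta> \<noteq> {}))))"
proof -
  \<comment> \<open>This comes from the estimate \<open>g / (3 * (k + 1)) \<le> n\<close>. The upper
    constant \<open>2\<close> leaves room for the side loop besides at most
    \<open>g ^ (k + 1)\<close> others.\<close>
  define c where "c = (1 / (3 * real (k + 1))) ^ (k + 1)"
  have "\<exists>\<Gamma>. k_system (genus_surface g) k \<Gamma> \<and> finite \<Gamma> \<and>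
         c * real g ^ (k + 1) \<le> real (card \<Gamma>) \<and>
         real (card \<Gamma>) \<le> 2 * real g ^ (k + 1) \<and>
         (k > 0 \<longrightarrow> (\<exists>\<gamma>\<in>\<Gamma>. \<forall>\<delta>\<in>\<Gamma> - {\<gamma>}. \<gamma> \<inter> \<delta> \<noteq> {}))" if "g \<ge> 2" for g
  proof -
    have c_mult: "c * real g ^ (k + 1) = (real g / (3 * real (k + 1))) ^ (k + 1)"
      unfolding c_def by (simp only: power_mult_distrib[symmetric]) simp
    have g1: "1 \<le> real g ^ (k + 1)" using that by (intro one_le_power) simp
    show ?thesis
    \<comment> \<open>For small \<open>g\<close> the blocks are too short for a choice of depths,
      but the lower bound is then at most \<open>1\<close>, and a single loop suffices, vacuously
      meeting all others.\<close>
    proof (cases "g < 2 * (k + 1)")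
      case True
      have "real g / (3 * real (k + 1)) \<le> 1"
        using True by (simp add: divide_simps)
      then have "(real g / (3 * real (k + 1))) ^ (k + 1) \<le> 1"
        by (intro power_le_one) auto
      then show ?thesis
        using simple_loop_side_loop[of 0 g] that g1 unfolding c_mult
        by (intro exI[of _ "{side_loop g 0}"]) (auto simp: k_system_def)
    next
      case False
      \<comment> \<open>One handle of each block is reserved for the additional crossing, hence the
        \<open>- 1\<close>.\<close>
      define n where "n = g div (k + 1) - 1"
      have "2 \<le> g div (k + 1)"
        using False less_eq_div_iff_mult_less_eq[of "k + 1" 2 g] by simp
      then have n: "0 < n" "n + 1 = g div (k + 1)" by (auto simp: n_def)
      have room: "(k + 1) * (n + 1) \<le> g"
        unfolding n(2) by (rule times_div_less_eq_dividend)
      have "g < (k + 1) * (n + 2)"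
      proof -
        have "g = (k + 1) * (g div (k + 1)) + g mod (k + 1)" by (rule mult_div_mod_eq[symmetric])
        also have "\<dots> < (k + 1) * (n + 1) + (k + 1)" unfolding n(2) by (intro add_strict_left_mono mod_less_divisor) simp
        finally show ?thesis by (simp add: algebra_simps)
      qed
      \<comment> \<open>The factor \<open>3\<close> arises from \<open>n + 2 \<le> 3 * n\<close>,
        valid for positive \<open>n\<close>.\<close>
      also have "\<dots> \<le> (k + 1) * (3 * n)" using n by (intro mult_left_mono) auto
      finally have "g \<le> 3 * (k + 1) * n" by (simp only: ac_simps less_imp_le)
      then have "real g \<le> real (3 * (k + 1) * n)" by (rule of_nat_mono)
      then have lower: "real g / (3 * real (k + 1)) \<le> real n"
        by (simp add: divide_simps algebra_simps)
      have "n + 1 \<le> (k + 1) * (n + 1)" by simp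
      then have "n \<le> g" using room by linarith
      have fin: "finite ({..k} \<rightarrow>\<^sub>E {..<n})" by (simp add: finite_PiE)
      obtain e :: "(nat \<Rightarrow> nat) \<Rightarrow> nat" where e: "inj_on e ({..k} \<rightarrow>\<^sub>E {..<n})"
        using finite_imp_inj_to_nat_seg[OF fin] by blast
      \<comment> \<open>Any injective numbering provides ties; the summand \<open>2\<close> keeps
        the reciprocals strictly below one.\<close>
      interpret loop_family g k n "\<lambda>u. 1 / (real (e u) + 2)"
      proof
        show "inj_on (\<lambda>u. 1 / (real (e u) + 2)) ({..k} \<rightarrow>\<^sub>E {..<n})"
          using e by (auto simp: inj_on_def)
      qed (use n room in auto)
      have low: "c * real g ^ (k + 1) \<le> real (n ^ (k + 1))"
        unfolding c_mult of_nat_power using lower by (intro power_mono) auto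
      have up: "real (n ^ (k + 1)) \<le> real g ^ (k + 1)"
        unfolding of_nat_power using \<open>n \<le> g\<close> by (intro power_mono) auto
      show ?thesis
      \<comment> \<open>The side loop meets each loop of the family, so it may be added only if one
        intersection is allowed.\<close>
      proof (cases "k = 0")
        case True
        then show ?thesis
          using k_system_loops card_loops low up g1 by (intro exI[of _ "loop ` indices"]) simp
      next
        case False
        have "side_loop g 0 \<notin> loop ` indices" using side_not_loop by blast
        then have "card (insert (side_loop g 0) (loop ` indices)) = n ^ (k + 1) + 1"
          using card_loops by simp
        moreover have "side_loop g 0 \<inter> loop u \<noteq> {}" if "u \<in> indices" for u
          using loop_Int_side[OF that] by blast
        ultimately show ?thesis
          using k_system_hub False card_loops(1) low up g1
          by (intro exI[of _ "insert (side_loop g 0) (loop ` indices)"]) auto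
      qed
    qed
  qed
  moreover have "c > 0" by (simp add: c_def)
  ultimately show ?thesis by (intro exI[of _ c] exI[of _ 2]) auto
qed

end
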